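(* Let $a,m\in\mathbb{R}$ and let $u$ be the solution of the damped stochastic Klein-Gordon equation $(\partial_{tt}-\partial_{xx}+a\partial_t+m^2)u=\dot W$ on $t>0$, $x\in\mathbb{R}$, with $u(0,x)=\partial_t u(0,x)=0$. Fix $N>0$ and $0<a_1<a_2$. Then there exists a (deterministic) constant $0<K_2<\infty$ such that for all fixed $z_0\in[a_1,a_2]$, $$\mathbb{P}\left\{\limsup_{h\to0^+}\frac{\left|u\left(\frac{w+z_0}{\sqrt2}+h,\frac{-w+z_0}{\sqrt2}+h\right)-u\left(\frac{w+z_0}{\sqrt2},\frac{-w+z_0}{\sqrt2}\right)\right|}{\sqrt{h\log\log(1/h)}}\le K_2\ \text{ for all } w\in[0,N]\right\}=1.$$
   Context: $\dot W$ is Gaussian space-time white noise on $[0,\infty)\times\mathbb{R}$, defined on a complete probability space $(\Omega,\mathscr{F},\mathbb{P})$. The solution is the mild solution in the sense of Walsh, $$u(t,x)=\int_0^t\int_{-\infty}^\infty G(t-s,x-y)\,W(ds,dy),$$ a centered Gaussian random field, where $G$ is the fundamental solution of $\partial_{tt}-\partial_{xx}+a\partial_t+m^2$. Explicitly, the spatial Fourier transform $\hat G(t,\xi)=\int_{\mathbb{R}}G(t,x)e^{-ix\xi}dx$ is: $e^{-at/2}\,\frac{\sin(t\sqrt{\xi^2+m^2-a^2/4})}{\sqrt{\xi^2+m^2-a^2/4}}$ if $\xi^2>\frac{a^2}{4}-m^2$; $te^{-at/2}$ if $\xi^2=\frac{a^2}{4}-m^2$; and $e^{-at/2}\,\frac{\sinh(t\sqrt{a^2/4-m^2-\xi^2})}{\sqrt{a^2/4-m^2-\xi^2}}$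 if $\xi^2<\frac{a^2}{4}-m^2$. The field $u$ is taken to be its version with almost surely continuous sample paths on $[0,\infty)\times\mathbb{R}$. *)

theory Defs
  imports "HOL-Probability.Probability"
begin

section \<open>Gaussian space-time white noise\<close>

definition spacetime :: "(real \<times> real) set" where
  "spacetime = {0..} \<times> UNIV"

definition noise_sets :: "(real \<times> real) set set" where
  "noise_sets = {A \<in> sets borel. A \<subseteq> spacetime \<and> emeasure lborel A < \<infinity>}"

text \<open>The degenerate law (variance zero) has no density, hence the separate case.\<close>

definition centered_gaussian :: "'w measure \<Rightarrow> ('w \<Rightarrow> real) \<Rightarrow> bool" where
  "centered_gaussian M X \<longleftrightarrow>
     X \<in> borel_measurable M \<and>
     ((AE \<omega> in M. X \<omega> = 0) \<or> (\<exists>\<sigma>>0. distributed M lborel X (normal_density 0 \<sigma>)))"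

text \<open>Joint Gaussianity: every finite linear combination is Gaussian.\<close>

definition centered_gaussian_family :: "'w measure \<Rightarrow> 'i set \<Rightarrow> ('i \<Rightarrow> 'w \<Rightarrow> real) \<Rightarrow> bool" where
  "centered_gaussian_family M T X \<longleftrightarrow>
     (\<forall>I c. finite I \<and> I \<subseteq> T \<longrightarrow> centered_gaussian M (\<lambda>\<omega>. \<Sum>i\<in>I. c i * X i \<omega>))"

definition white_noise :: "'w measure \<Rightarrow> ((real \<times> real) set \<Rightarrow> 'w \<Rightarrow> real) \<Rightarrow> bool" where
  "white_noise M W \<longleftrightarrow>
     centered_gaussian_family M noise_sets W \<and>
     (\<forall>A\<in>noise_sets. \<forall>B\<in>noise_sets.
        integral\<^sup>L M (\<lambda>\<omega>. W A \<omega> * W B \<omega>) = measure lborel (A \<inter> B))"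


section \<open>The Wiener integral\<close>

text \<open>
  \<open>has_wiener_integral M W f X\<close> says that the random variable \<open>X\<close> is a version of the integral of the
  deterministic function \<open>f\<close> against \<open>W\<close>: simple functions \<open>\<Sum>A\<in>\<A> n. c n A * indicator A\<close> converge to
  \<open>f\<close> in \<open>L\<^sup>2\<close> of space-time, and their elementary integrals \<open>\<Sum>A\<in>\<A> n. c n A * W A\<close> converge to \<open>X\<close> in
  \<open>L\<^sup>2\<close> of the probability space. The squared \<open>L\<^sup>2\<close> distances are non-negative integrals, which are infinite
  (rather than zero) when square integrability fails.
\<close>

definition has_wiener_integral ::
  "'w measure \<Rightarrow> ((real \<times> real) set \<Rightarrow> 'w \<Rightarrow> real) \<Rightarrow> (real \<times> real \<Rightarrow> real) \<Rightarrow> ('w \<Rightarrow> real) \<Rightarrow> bool" where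
  "has_wiener_integral M W f X \<longleftrightarrow>
     f \<in> borel_measurable borel \<and> X \<in> borel_measurable M \<and>
     (\<exists>(\<A> :: nat \<Rightarrow> (real \<times> real) set set) (c :: nat \<Rightarrow> (real \<times> real) set \<Rightarrow> real).
        (\<forall>n. finite (\<A> n) \<and> \<A> n \<subseteq> noise_sets) \<and>
        (\<lambda>n. \<integral>\<^sup>+p\<in>spacetime. ennreal ((f p - (\<Sum>A\<in>\<A> n. c n A * indicator A p))\<^sup>2) \<partial>lborel)
          \<longlonglongrightarrow> 0 \<and>
        (\<lambda>n. \<integral>\<^sup>+\<omega>. ennreal ((X \<omega> - (\<Sum>A\<in>\<A> n. c n A * W A \<omega>))\<^sup>2) \<partial>M) \<longlonglongrightarrow> 0)"


section \<open>The damped Klein-Gordon equation\<close>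

definition G_hat :: "real \<Rightarrow> real \<Rightarrow> real \<Rightarrow> real \<Rightarrow> real" where
  "G_hat a m t \<xi> =
     (if \<xi>\<^sup>2 > a\<^sup>2 / 4 - m\<^sup>2 then
        exp (- a * t / 2) * (sin (t * sqrt (\<xi>\<^sup>2 + m\<^sup>2 - a\<^sup>2 / 4)) / sqrt (\<xi>\<^sup>2 + m\<^sup>2 - a\<^sup>2 / 4))
      else if \<xi>\<^sup>2 = a\<^sup>2 / 4 - m\<^sup>2 then
        t * exp (- a * t / 2)
      else
        exp (- a * t / 2) * (sinh (t * sqrt (a\<^sup>2 / 4 - m\<^sup>2 - \<xi>\<^sup>2)) / sqrt (a\<^sup>2 / 4 - m\<^sup>2 - \<xi>\<^sup>2)))"

text \<open>
  The fundamental solution of \<open>\<partial>\<^sub>t\<^sub>t - \<partial>\<^sub>x\<^sub>x + a\<partial>\<^sub>t + m\<^sup>2\<close>, given by its spatial Fourier transform with the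
  convention \<open>\<integral>G(t,x) e\<^sup>-\<^sup>i\<^sup>x\<^sup>\<xi> dx\<close>. For each \<open>t\<close> this determines \<open>G t\<close> up to a Lebesgue null set, which
  does not affect the Wiener integral of \<open>G\<close>.
\<close>

definition fundamental_solution :: "real \<Rightarrow> real \<Rightarrow> (real \<Rightarrow> real \<Rightarrow> real) \<Rightarrow> bool" where
  "fundamental_solution a m G \<longleftrightarrow>
     (\<lambda>(t, x). G t x) \<in> borel_measurable borel \<and>
     (\<forall>t>0. integrable lborel (G t) \<and>
        (\<forall>\<xi>. integral\<^sup>L lborel (\<lambda>x. complex_of_real (G t x) * exp (- (\<i> * of_real (x * \<xi>)))) =
              complex_of_real (G_hat a m t \<xi>)))"

definition mild_solution ::
  "'w measure \<Rightarrow> ((real \<times> real) set \<Rightarrow> 'w \<Rightarrow> real) \<Rightarrow> (real \<Rightarrow> real \<Rightarrow> real)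
    \<Rightarrow> (real \<Rightarrow> real \<Rightarrow> 'w \<Rightarrow> real) \<Rightarrow> bool" where
  "mild_solution M W G u \<longleftrightarrow>
     (\<forall>t\<ge>0. \<forall>x. has_wiener_integral M W
        (\<lambda>(s, y). if 0 \<le> s \<and> s < t then G (t - s) (x - y) else 0) (u t x))"

definition continuous_paths :: "'w measure \<Rightarrow> (real \<Rightarrow> real \<Rightarrow> 'w \<Rightarrow> real) \<Rightarrow> bool" where
  "continuous_paths M u \<longleftrightarrow> (AE \<omega> in M. continuous_on spacetime (\<lambda>(t, x). u t x \<omega>))"

end

theory Submission
  imports Defs
begin

text \<open>
  In the light-cone coordinates \<open>q = t - x\<close> and \<open>p = t + x\<close>, put \<open>v q p = u ((q + p) / 2) ((p - q) / 2)\<close>.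
  The displacement \<open>(h, h)\<close> raises \<open>p\<close> by \<open>2 * h\<close> and keeps \<open>q\<close>, so the claim is an upper law of
  the iterated logarithm for \<open>p \<mapsto> v q p\<close> at a fixed \<open>p0\<close>, with one exceptional null set for all \<open>q\<close>
  in a compact interval.

  The reason is that \<open>v\<close> resembles a Brownian sheet: its increment over a rectangle in the \<open>(q, p)\<close>
  plane has variance at most a constant times the area. Rescaled to the unit square, the field
  \<open>(q, \<rho>) \<mapsto> (v q (p0 + \<rho>) - v q p0) / sqrt \<delta>\<close> with \<open>0 \<le> \<rho> \<le> \<delta>\<close> therefore has Gaussian increments
  whose variance is bounded by the distance, uniformly in \<open>\<delta>\<close>. Chaining along dyadic grids shows that
  its supremum over \<^emph>\<open>all\<close> \<open>q\<close> and \<open>\<rho>\<close> has, up to constants, the tail of a single Gaussian variable,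
  so that the uniformity in \<open>q\<close> only costs a constant factor. For \<open>\<delta> = exp (- n)\<close> the supremum exceeds a large
  multiple of \<open>sqrt (ln n)\<close> with summable probability (\<open>chaining_sqrt_ln_bound\<close>), Borel--Cantelli applies, and
  \<open>ln n\<close> is comparable to \<open>ln (ln (1 / \<delta>))\<close>.

  The variance bound comes from the isometry of the Wiener integral, which turns it into an \<open>L\<^sup>2\<close> bound
  for the corresponding combination of four shifted kernels (\<open>cone_kernel_rectangle_L2\<close>). For this the kernel
  is needed in closed form. With \<open>\<kappa> = m\<^sup>2 - a\<^sup>2 / 4\<close> and the Bessel function \<open>J\<^sub>0\<close> it is
  \<open>G t x = exp (- a * t / 2) / 2 * J\<^sub>0 (sqrt (\<kappa> * (t\<^sup>2 - x\<^sup>2)))\<close> for \<open>\<bar>x\<bar> < t\<close> and zero elsewhere, for almost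
  every \<open>x\<close>: the Fourier transform of this function is computed from its power series, and integrable functions
  are determined by their Fourier transforms (\<open>fundamental_solution_AE_kg_kernel\<close>). Inside the light
  cone the kernel is smooth, and it jumps only across the two characteristics; hence the four shifted
  kernels cancel except on thin strips along the characteristics and on one small rectangle.

  All constants depend only on an upper bound for \<open>q + p\<close>, which makes the final constant uniform in \<open>z0\<close>.
\<close>

section \<open>Gaussian tails of Wiener integrals\<close>

text \<open>
  Half of the exponent of the density pays for the tail factor; the other half is
  the density of a Gaussian law with twice the variance, up to the factor \<open>sqrt 2\<close>.
\<close>

lemma normal_abs_tail:
  assumes M: "prob_space M" and X: "distributed M lborel X (normal_density 0 \<sigma>)"
    and s: "\<sigma> > 0" and l: "l \<ge> 0"
  shows "measure M {\<omega>\<in>space M. \<bar>X \<omega>\<bar> > l} \<le> 2 * exp (- (l\<^sup>2 / (4 * \<sigma>\<^sup>2)))"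
proof -
  interpret prob_space M by fact
  let ?A = "{x::real. \<bar>x\<bar> > l}"
  let ?c = "sqrt 2 * exp (- (l\<^sup>2 / (4 * \<sigma>\<^sup>2)))"
  have key: "normal_density 0 \<sigma> x \<le> ?c * normal_density 0 (sqrt 2 * \<sigma>) x" if "\<bar>x\<bar> > l" for x
  proof -
    have "l\<^sup>2 \<le> x\<^sup>2" using that l by (metis abs_le_square_iff abs_of_nonneg less_imp_le)
    then have "exp (- (x\<^sup>2 / (2 * \<sigma>\<^sup>2))) \<le> exp (- (l\<^sup>2 / (4 * \<sigma>\<^sup>2)) - x\<^sup>2 / (4 * \<sigma>\<^sup>2))"
      using s by (simp add: field_simps)
    also have "\<dots> = exp (- (l\<^sup>2 / (4 * \<sigma>\<^sup>2))) * exp (- (x\<^sup>2 / (4 * \<sigma>\<^sup>2)))"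
      by (simp add: exp_add[symmetric])
    finally have e: "exp (- (x\<^sup>2 / (2 * \<sigma>\<^sup>2))) \<le> exp (- (l\<^sup>2 / (4 * \<sigma>\<^sup>2))) * exp (- (x\<^sup>2 / (4 * \<sigma>\<^sup>2)))" .
    have sq: "sqrt (2 * pi * (sqrt 2 * \<sigma>)\<^sup>2) = sqrt 2 * sqrt (2 * pi * \<sigma>\<^sup>2)"
      by (simp add: power_mult_distrib real_sqrt_mult[symmetric])
    have "?c * normal_density 0 (sqrt 2 * \<sigma>) x
        = (1 / sqrt (2 * pi * \<sigma>\<^sup>2)) * (exp (- (l\<^sup>2 / (4 * \<sigma>\<^sup>2))) * exp (- (x\<^sup>2 / (4 * \<sigma>\<^sup>2))))"
      unfolding normal_density_def sq by (simp add: power_mult_distrib)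
    also have "\<dots> \<ge> (1 / sqrt (2 * pi * \<sigma>\<^sup>2)) * exp (- (x\<^sup>2 / (2 * \<sigma>\<^sup>2)))"
      using e by (intro mult_left_mono) auto
    finally show ?thesis by (simp add: normal_density_def)
  qed
  have "emeasure M (X -` ?A \<inter> space M)
      = (\<integral>\<^sup>+x. ennreal (normal_density 0 \<sigma> x) * indicator ?A x \<partial>lborel)"
    by (rule distributed_emeasure[OF X]) simp
  also have "\<dots> \<le> (\<integral>\<^sup>+x. ennreal (?c * normal_density 0 (sqrt 2 * \<sigma>) x) \<partial>lborel)"
    by (rule nn_integral_mono) (auto simp: indicator_def intro!: ennreal_leI key)
  also have "\<dots> = ennreal ?c"
    using s by (subst nn_integral_eq_integral) (auto simp: mult.commute)
  finally have *: "emeasure M (X -` ?A \<inter> space M) \<le> ennreal ?c" .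
  have "X -` ?A \<inter> space M = {\<omega>\<in>space M. \<bar>X \<omega>\<bar> > l}" by auto
  with * have "measure M {\<omega>\<in>space M. \<bar>X \<omega>\<bar> > l} \<le> ?c"
    by (simp add: emeasure_eq_measure)
  also have "\<dots> \<le> 2 * exp (- (l\<^sup>2 / (4 * \<sigma>\<^sup>2)))"
    by (intro mult_right_mono) (auto intro: real_le_lsqrt)
  finally show ?thesis .
qed

lemma normal_second_moment:
  assumes X: "distributed M lborel X (normal_density 0 \<sigma>)" and s: "\<sigma> > 0"
  shows "(\<integral>\<^sup>+\<omega>. ennreal ((X \<omega>)\<^sup>2) \<partial>M) = ennreal (\<sigma>\<^sup>2)"
proof -
  have "(\<integral>\<^sup>+\<omega>. ennreal ((X \<omega>)\<^sup>2) \<partial>M)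
      = (\<integral>\<^sup>+x. ennreal (normal_density 0 \<sigma> x) * ennreal (x\<^sup>2) \<partial>lborel)"
    by (rule distributed_nn_integral[OF X, symmetric]) simp
  also have "\<dots> = (\<integral>\<^sup>+x. ennreal (normal_density 0 \<sigma> x * x\<^sup>2) \<partial>lborel)"
    by (simp add: ennreal_mult)
  also have "\<dots> = ennreal (\<sigma>\<^sup>2)"
    using normal_moment_even[OF s, of 0 1] s
    by (subst nn_integral_eq_integral)
       (auto simp: has_bochner_integral_iff fact_numeral)
  finally show ?thesis .
qed

lemma centered_gaussian_abs_tail:
  assumes M: "prob_space M" and X: "centered_gaussian M X"
    and v: "(\<integral>\<^sup>+\<omega>. ennreal ((X \<omega>)\<^sup>2) \<partial>M) \<le> ennreal v" "v > 0" and l: "l \<ge> 0"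
  shows "measure M {\<omega>\<in>space M. \<bar>X \<omega>\<bar> > l} \<le> 2 * exp (- (l\<^sup>2 / (4 * v)))"
proof -
  interpret prob_space M by fact
  have [measurable]: "X \<in> borel_measurable M" using X by (simp add: centered_gaussian_def)
  consider "AE \<omega> in M. X \<omega> = 0" | \<sigma> where "\<sigma> > 0" "distributed M lborel X (normal_density 0 \<sigma>)"
    using X by (auto simp: centered_gaussian_def)
  then show ?thesis
  proof cases
    case 1
    have "emeasure M {\<omega>\<in>space M. \<bar>X \<omega>\<bar> > l} = 0"
      by (rule emeasure_eq_0_AE) (use 1 l in auto)
    then show ?thesis by (simp add: measure_def)
  next
    case 2
    have le: "\<sigma>\<^sup>2 \<le> v"
      using v normal_second_moment[OF 2(2,1)] by simp
    have "measure M {\<omega>\<in>space M. \<bar>X \<omega>\<bar> > l} \<le> 2 * exp (- (l\<^sup>2 / (4 * \<sigma>\<^sup>2)))"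
      by (rule normal_abs_tail[OF M 2(2,1) l])
    also have "\<dots> \<le> 2 * exp (- (l\<^sup>2 / (4 * v)))"
      using le 2(1) v(2) by (auto intro!: divide_left_mono)
    finally show ?thesis .
  qed
qed

lemma centered_gaussian_square_integrable:
  assumes X: "centered_gaussian M X"
  shows "integrable M (\<lambda>\<omega>. (X \<omega>)\<^sup>2)"
proof -
  have [measurable]: "X \<in> borel_measurable M" using X by (simp add: centered_gaussian_def)
  consider "AE \<omega> in M. X \<omega> = 0" | \<sigma> where "\<sigma> > 0" "distributed M lborel X (normal_density 0 \<sigma>)"
    using X by (auto simp: centered_gaussian_def)
  then show ?thesis
  proof cases
    case 1
    then have ae: "AE \<omega> in M. 0 = (X \<omega>)\<^sup>2" by auto
    show ?thesis
      by (rule integrable_cong_AE_imp[OF _ _ ae]) auto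
  next
    case 2
    show ?thesis
      by (rule integrableI_bounded) (auto simp: normal_second_moment[OF 2(2,1)])
  qed
qed

lemma white_noise_centered_gaussian:
  assumes W: "white_noise M W" and A: "A \<in> noise_sets"
  shows "centered_gaussian M (W A)"
proof -
  have "centered_gaussian M (\<lambda>\<omega>. \<Sum>i\<in>{A}. 1 * W i \<omega>)"
    using W A unfolding white_noise_def centered_gaussian_family_def
    by (elim conjE allE[of _ "{A}"] allE[of _ "\<lambda>_. 1"]) auto
  then show ?thesis by simp
qed

text \<open>
  Both sides are the quadratic form \<open>\<Sum>A. \<Sum>B. c A * c B * measure lborel (A \<inter> B)\<close>.
\<close>

lemma white_noise_simple_isometry:
  assumes W: "white_noise M W" and I: "finite I" "I \<subseteq> noise_sets"
  shows "(\<integral>\<^sup>+\<omega>. ennreal ((\<Sum>A\<in>I. c A * W A \<omega>)\<^sup>2) \<partial>M)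
       = (\<integral>\<^sup>+p\<in>spacetime. ennreal ((\<Sum>A\<in>I. c A * indicator A p)\<^sup>2) \<partial>lborel)"
proof -
  note cg = white_noise_centered_gaussian[OF W]
  have meas: "A \<in> noise_sets \<Longrightarrow> W A \<in> borel_measurable M" for A
    using cg by (simp add: centered_gaussian_def)
  have cov: "integral\<^sup>L M (\<lambda>\<omega>. W A \<omega> * W B \<omega>) = measure lborel (A \<inter> B)"
    if "A \<in> I" "B \<in> I" for A B using W that I by (auto simp: white_noise_def)
  have int: "integrable M (\<lambda>\<omega>. W A \<omega> * W B \<omega>)" if "A \<in> I" "B \<in> I" for A B
  proof (rule Bochner_Integration.integrable_bound[where f = "\<lambda>\<omega>. (W A \<omega>)\<^sup>2 + (W B \<omega>)\<^sup>2"])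
    show "integrable M (\<lambda>\<omega>. (W A \<omega>)\<^sup>2 + (W B \<omega>)\<^sup>2)"
      using that I cg by (intro Bochner_Integration.integrable_add centered_gaussian_square_integrable) auto
    show "(\<lambda>\<omega>. W A \<omega> * W B \<omega>) \<in> borel_measurable M"
      using that I meas by (intro borel_measurable_times) auto
    have "\<bar>x * y\<bar> \<le> x\<^sup>2 + y\<^sup>2" for x y :: real
    proof -
      have "0 \<le> (\<bar>x\<bar> - \<bar>y\<bar>)\<^sup>2" "0 \<le> \<bar>x\<bar> * \<bar>y\<bar>" by auto
      moreover have "(\<bar>x\<bar> - \<bar>y\<bar>)\<^sup>2 = x\<^sup>2 + y\<^sup>2 - 2 * (\<bar>x\<bar> * \<bar>y\<bar>)"
        by (simp add: power2_diff)
      ultimately show ?thesis unfolding abs_mult by linarith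
    qed
    then show "AE \<omega> in M. norm (W A \<omega> * W B \<omega>) \<le> norm ((W A \<omega>)\<^sup>2 + (W B \<omega>)\<^sup>2)"
      by auto
  qed
  have sq: "(\<Sum>A\<in>I. f A)\<^sup>2 = (\<Sum>A\<in>I. \<Sum>B\<in>I. f A * f B)" for f :: "_ \<Rightarrow> real"
    by (simp add: power2_eq_square sum_product)
  let ?S = "\<Sum>A\<in>I. \<Sum>B\<in>I. c A * c B * measure lborel (A \<inter> B)"
  have e1: "(\<Sum>A\<in>I. c A * W A \<omega>)\<^sup>2 = (\<Sum>A\<in>I. \<Sum>B\<in>I. c A * c B * (W A \<omega> * W B \<omega>))" for \<omega>
    unfolding sq by (simp add: ac_simps)
  have i1: "integrable M (\<lambda>\<omega>. (\<Sum>A\<in>I. c A * W A \<omega>)\<^sup>2)"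
    unfolding e1 using int by (intro Bochner_Integration.integrable_sum integrable_mult_right) auto
  have "(\<integral>\<^sup>+\<omega>. ennreal ((\<Sum>A\<in>I. c A * W A \<omega>)\<^sup>2) \<partial>M)
      = ennreal (integral\<^sup>L M (\<lambda>\<omega>. (\<Sum>A\<in>I. c A * W A \<omega>)\<^sup>2))"
    by (rule nn_integral_eq_integral[OF i1]) auto
  also have "integral\<^sup>L M (\<lambda>\<omega>. (\<Sum>A\<in>I. c A * W A \<omega>)\<^sup>2) = ?S"
    unfolding e1 using int by (simp add: Bochner_Integration.integral_sum cov)
  finally have 1: "(\<integral>\<^sup>+\<omega>. ennreal ((\<Sum>A\<in>I. c A * W A \<omega>)\<^sup>2) \<partial>M) = ennreal ?S" .
  have int2: "integrable lborel (\<lambda>p. indicator (A \<inter> B) p :: real)" if "A \<in> I" "B \<in> I" for A B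
  proof -
    have b: "A \<in> sets borel" "B \<in> sets borel" "emeasure lborel A < \<infinity>"
      using that I by (auto simp: noise_sets_def)
    have "emeasure lborel (A \<inter> B) \<le> emeasure lborel A"
      using b by (intro emeasure_mono) auto
    with b show ?thesis by (intro integrable_real_indicator) (auto simp: le_less_trans)
  qed
  have e2: "(\<Sum>A\<in>I. c A * indicator A p)\<^sup>2 = (\<Sum>A\<in>I. \<Sum>B\<in>I. c A * c B * indicator (A \<inter> B) p)" for p
    unfolding sq by (simp add: ac_simps indicator_inter_arith)
  have z: "(\<Sum>A\<in>I. c A * indicator A p) = 0" if "p \<notin> spacetime" for p
    using that I by (intro sum.neutral) (auto simp: noise_sets_def indicator_def)
  have i2: "integrable lborel (\<lambda>p. (\<Sum>A\<in>I. c A * indicator A p)\<^sup>2)"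
    unfolding e2 using int2 by (intro Bochner_Integration.integrable_sum integrable_mult_right) auto
  have "(\<integral>\<^sup>+p\<in>spacetime. ennreal ((\<Sum>A\<in>I. c A * indicator A p)\<^sup>2) \<partial>lborel)
      = (\<integral>\<^sup>+p. ennreal ((\<Sum>A\<in>I. c A * indicator A p)\<^sup>2) \<partial>lborel)"
    by (intro nn_integral_cong) (auto simp: indicator_def[of spacetime] z)
  also have "\<dots> = ennreal (integral\<^sup>L lborel (\<lambda>p. (\<Sum>A\<in>I. c A * indicator A p)\<^sup>2))"
    by (rule nn_integral_eq_integral[OF i2]) auto
  also have "integral\<^sup>L lborel (\<lambda>p. (\<Sum>A\<in>I. c A * indicator A p)\<^sup>2) = ?S"
    unfolding e2 using int2 by (simp add: Bochner_Integration.integral_sum)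
  finally show ?thesis using 1 by simp
qed

text \<open>
  Both \<open>L\<^sup>2\<close> limits in the definition of the Wiener integral have this form, the weight \<open>k\<close>
  being the indicator of space-time for one and \<open>1\<close> for the other.
\<close>

lemma L2_limit_lincomb:
  fixes b :: real
  assumes 1: "(\<lambda>n. \<integral>\<^sup>+x. ennreal ((F x - P n x)\<^sup>2) * ennreal (k x) \<partial>N) \<longlonglongrightarrow> 0"
    and 2: "(\<lambda>n. \<integral>\<^sup>+x. ennreal ((H x - Q n x)\<^sup>2) * ennreal (k x) \<partial>N) \<longlonglongrightarrow> 0"
    and [measurable]: "F \<in> borel_measurable N" "H \<in> borel_measurable N" "\<And>n. P n \<in> borel_measurable N"
      "\<And>n. Q n \<in> borel_measurable N" "k \<in> borel_measurable N"
  shows "(\<lambda>n. \<integral>\<^sup>+x. ennreal ((F x + b * H x - (P n x + b * Q n x))\<^sup>2) * ennreal (k x) \<partial>N) \<longlonglongrightarrow> 0"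
proof -
  have sqb: "(x + b * y)\<^sup>2 \<le> 2 * x\<^sup>2 + 2 * b\<^sup>2 * y\<^sup>2" for x y :: real
    using zero_le_power2[of "x - b * y"] by (simp add: power2_sum power2_diff power_mult_distrib)
  have ennsq: "ennreal ((x + b * y)\<^sup>2) \<le> 2 * ennreal (x\<^sup>2) + ennreal (2 * b\<^sup>2) * ennreal (y\<^sup>2)" for x y
  proof -
    have "ennreal ((x + b * y)\<^sup>2) \<le> ennreal (2 * x\<^sup>2 + 2 * b\<^sup>2 * y\<^sup>2)" by (intro ennreal_leI sqb)
    also have "\<dots> = 2 * ennreal (x\<^sup>2) + ennreal (2 * b\<^sup>2) * ennreal (y\<^sup>2)"
      by (simp add: ennreal_mult ennreal_plus)
    finally show ?thesis .
  qed
  have lim: "(\<lambda>n. 2 * p n + ennreal (2 * b\<^sup>2) * q n) \<longlonglongrightarrow> 0"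
    if "p \<longlonglongrightarrow> 0" "q \<longlonglongrightarrow> 0" for p q :: "nat \<Rightarrow> ennreal"
  proof -
    have "(\<lambda>n. 2 * p n + ennreal (2 * b\<^sup>2) * q n) \<longlonglongrightarrow> 2 * 0 + ennreal (2 * b\<^sup>2) * 0"
      using that by (intro tendsto_add ennreal_tendsto_cmult) auto
    then show ?thesis by simp
  qed
  show ?thesis
  proof (rule tendsto_sandwich[OF _ _ tendsto_const lim[OF 1 2]])
    show "\<forall>\<^sub>F n in sequentially. 0 \<le> (\<integral>\<^sup>+x. ennreal ((F x + b * H x - (P n x + b * Q n x))\<^sup>2) * ennreal (k x) \<partial>N)"
      by auto
    have pt: "ennreal ((F x + b * H x - (P n x + b * Q n x))\<^sup>2) * ennreal (k x)
       \<le> 2 * (ennreal ((F x - P n x)\<^sup>2) * ennreal (k x))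
         + ennreal (2 * b\<^sup>2) * (ennreal ((H x - Q n x)\<^sup>2) * ennreal (k x))" for n x
    proof -
      have e: "F x + b * H x - (P n x + b * Q n x) = (F x - P n x) + b * (H x - Q n x)"
        by (simp add: algebra_simps)
      have "ennreal ((F x + b * H x - (P n x + b * Q n x))\<^sup>2) * ennreal (k x)
        \<le> (2 * ennreal ((F x - P n x)\<^sup>2) + ennreal (2 * b\<^sup>2) * ennreal ((H x - Q n x)\<^sup>2)) * ennreal (k x)"
        unfolding e by (intro mult_right_mono ennsq) auto
      then show ?thesis by (simp add: distrib_right mult.assoc)
    qed
    have "(\<integral>\<^sup>+x. ennreal ((F x + b * H x - (P n x + b * Q n x))\<^sup>2) * ennreal (k x) \<partial>N)
       \<le> (\<integral>\<^sup>+x. 2 * (ennreal ((F x - P n x)\<^sup>2) * ennreal (k x))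
         + ennreal (2 * b\<^sup>2) * (ennreal ((H x - Q n x)\<^sup>2) * ennreal (k x)) \<partial>N)" for n
      by (intro nn_integral_mono pt)
    also have "(\<integral>\<^sup>+x. 2 * (ennreal ((F x - P n x)\<^sup>2) * ennreal (k x))
         + ennreal (2 * b\<^sup>2) * (ennreal ((H x - Q n x)\<^sup>2) * ennreal (k x)) \<partial>N)
       = 2 * (\<integral>\<^sup>+x. ennreal ((F x - P n x)\<^sup>2) * ennreal (k x) \<partial>N)
        + ennreal (2 * b\<^sup>2) * (\<integral>\<^sup>+x. ennreal ((H x - Q n x)\<^sup>2) * ennreal (k x) \<partial>N)" for n
      by (simp add: nn_integral_add nn_integral_cmult)
    finally show "\<forall>\<^sub>F n in sequentially. (\<integral>\<^sup>+x. ennreal ((F x + b * H x - (P n x + b * Q n x))\<^sup>2) * ennreal (k x) \<partial>N)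
       \<le> 2 * (\<integral>\<^sup>+x. ennreal ((F x - P n x)\<^sup>2) * ennreal (k x) \<partial>N)
        + ennreal (2 * b\<^sup>2) * (\<integral>\<^sup>+x. ennreal ((H x - Q n x)\<^sup>2) * ennreal (k x) \<partial>N)"
      by auto
  qed
qed

text \<open>
  The approximating simple functions of \<open>f\<close> and \<open>g\<close> live on different families of sets; they
  are combined on the union of the two families, with coefficient zero where a set is absent.
\<close>

lemma has_wiener_integral_lincomb:
  assumes W: "white_noise M W"
    and f: "has_wiener_integral M W f X" and g: "has_wiener_integral M W g Y"
  shows "has_wiener_integral M W (\<lambda>p. f p + b * g p) (\<lambda>\<omega>. X \<omega> + b * Y \<omega>)"
proof -
  obtain A c where A: "\<And>n. finite (A n) \<and> A n \<subseteq> noise_sets"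
    and A1: "(\<lambda>n. \<integral>\<^sup>+p\<in>spacetime. ennreal ((f p - (\<Sum>B\<in>A n. c n B * indicator B p))\<^sup>2) \<partial>lborel) \<longlonglongrightarrow> 0"
    and A2: "(\<lambda>n. \<integral>\<^sup>+\<omega>. ennreal ((X \<omega> - (\<Sum>B\<in>A n. c n B * W B \<omega>))\<^sup>2) \<partial>M) \<longlonglongrightarrow> 0"
    and [measurable]: "f \<in> borel_measurable borel" "X \<in> borel_measurable M"
    using f unfolding has_wiener_integral_def by blast
  obtain A' c' where A': "\<And>n. finite (A' n) \<and> A' n \<subseteq> noise_sets"
    and A'1: "(\<lambda>n. \<integral>\<^sup>+p\<in>spacetime. ennreal ((g p - (\<Sum>B\<in>A' n. c' n B * indicator B p))\<^sup>2) \<partial>lborel) \<longlonglongrightarrow> 0"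
    and A'2: "(\<lambda>n. \<integral>\<^sup>+\<omega>. ennreal ((Y \<omega> - (\<Sum>B\<in>A' n. c' n B * W B \<omega>))\<^sup>2) \<partial>M) \<longlonglongrightarrow> 0"
    and [measurable]: "g \<in> borel_measurable borel" "Y \<in> borel_measurable M"
    using g unfolding has_wiener_integral_def by blast
  define D where "D n = A n \<union> A' n" for n
  define d where "d n B = (if B \<in> A n then c n B else 0) + b * (if B \<in> A' n then c' n B else 0)" for n B
  have sum: "(\<Sum>B\<in>D n. d n B * h B) = (\<Sum>B\<in>A n. c n B * h B) + b * (\<Sum>B\<in>A' n. c' n B * h B)"
    for n and h :: "_ \<Rightarrow> real"
  proof -
    have "(\<Sum>B\<in>D n. (if B \<in> A n then c n B else 0) * h B) = (\<Sum>B\<in>A n. c n B * h B)"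
      using A[of n] A'[of n] by (intro sum.mono_neutral_cong_right) (auto simp: D_def)
    moreover have "(\<Sum>B\<in>D n. (if B \<in> A' n then c' n B else 0) * h B) = (\<Sum>B\<in>A' n. c' n B * h B)"
      using A[of n] A'[of n] by (intro sum.mono_neutral_cong_right) (auto simp: D_def)
    moreover have "(\<Sum>B\<in>D n. d n B * h B) = (\<Sum>B\<in>D n. (if B \<in> A n then c n B else 0) * h B)
        + b * (\<Sum>B\<in>D n. (if B \<in> A' n then c' n B else 0) * h B)"
      unfolding d_def distrib_right sum.distrib sum_distrib_left mult.assoc ..
    ultimately show ?thesis by simp
  qed
  have WA: "W B \<in> borel_measurable M" if "B \<in> noise_sets" for B
    using white_noise_centered_gaussian[OF W that] by (simp add: centered_gaussian_def)
  have Wm: "(\<lambda>\<omega>. \<Sum>B\<in>I. h B * W B \<omega>) \<in> borel_measurable M" if "I \<subseteq> noise_sets" for I h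
    using that by (intro borel_measurable_sum borel_measurable_times) (auto intro: WA)
  have Bm: "(\<lambda>p. \<Sum>B\<in>I. h B * indicator B p) \<in> borel_measurable borel"
    if "I \<subseteq> noise_sets" for I and h :: "_ \<Rightarrow> real"
    using that by (intro borel_measurable_sum borel_measurable_times borel_measurable_indicator)
       (auto simp: noise_sets_def)
  have sp[measurable]: "spacetime \<in> sets borel"
    unfolding spacetime_def by (intro borel_closed closed_Times) auto
  have ind: "indicator spacetime p = ennreal (indicator spacetime p)" for p
    by (simp add: indicator_def)
  have l1: "(\<lambda>n. \<integral>\<^sup>+p\<in>spacetime. ennreal ((f p + b * g p - (\<Sum>B\<in>D n. d n B * indicator B p))\<^sup>2) \<partial>lborel) \<longlonglongrightarrow> 0"
    unfolding sum ind
  proof (intro L2_limit_lincomb)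
    show "(\<lambda>p. \<Sum>B\<in>A n. c n B * indicator B p) \<in> borel_measurable lborel" for n
      unfolding measurable_lborel1 measurable_lborel2 by (rule Bm) (use A[of n] in blast)
    show "(\<lambda>p. \<Sum>B\<in>A' n. c' n B * indicator B p) \<in> borel_measurable lborel" for n
      unfolding measurable_lborel1 measurable_lborel2 by (rule Bm) (use A'[of n] in blast)
    show "(\<lambda>n. \<integral>\<^sup>+p. ennreal ((f p - (\<Sum>B\<in>A n. c n B * indicator B p))\<^sup>2) * ennreal (indicator spacetime p) \<partial>lborel) \<longlonglongrightarrow> 0"
      using A1 unfolding ind .
    show "(\<lambda>n. \<integral>\<^sup>+p. ennreal ((g p - (\<Sum>B\<in>A' n. c' n B * indicator B p))\<^sup>2) * ennreal (indicator spacetime p) \<partial>lborel) \<longlonglongrightarrow> 0"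
      using A'1 unfolding ind .
  qed simp_all
  have l2: "(\<lambda>n. \<integral>\<^sup>+\<omega>. ennreal ((X \<omega> + b * Y \<omega> - (\<Sum>B\<in>D n. d n B * W B \<omega>))\<^sup>2) \<partial>M) \<longlonglongrightarrow> 0"
    unfolding sum using L2_limit_lincomb[where b = b and N = M and k = "\<lambda>_. 1" and F = X and H = Y
        and P = "\<lambda>n \<omega>. \<Sum>B\<in>A n. c n B * W B \<omega>" and Q = "\<lambda>n \<omega>. \<Sum>B\<in>A' n. c' n B * W B \<omega>"] A A' A2 A'2
    by (auto intro!: Wm)
  show ?thesis
    unfolding has_wiener_integral_def
    by (intro conjI exI[of _ D] exI[of _ d] l1 l2) (use A A' in \<open>auto simp: D_def\<close>)
qed

text \<open>
  The tail bound passes from simple functions to the limit because \<open>L\<^sup>2\<close> convergence implies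
  convergence in probability. The constant is \<open>64 = 4 * 4 * 4\<close>: one factor from the Gaussian tail, one from
  splitting the threshold into two halves, and one from bounding the variance of the approximations by \<open>4 * v\<close>.
\<close>

lemma has_wiener_integral_abs_tail:
  assumes M: "prob_space M" and W: "white_noise M W" and X: "has_wiener_integral M W f X"
    and v: "(\<integral>\<^sup>+p\<in>spacetime. ennreal ((f p)\<^sup>2) \<partial>lborel) \<le> ennreal v" "v > 0" and l: "l > 0"
  shows "measure M {\<omega>\<in>space M. \<bar>X \<omega>\<bar> > l} \<le> 2 * exp (- (l\<^sup>2 / (64 * v)))"
proof -
  interpret prob_space M by fact
  obtain A c where A: "\<And>n. finite (A n) \<and> A n \<subseteq> noise_sets"
    and A1: "(\<lambda>n. \<integral>\<^sup>+p\<in>spacetime. ennreal ((f p - (\<Sum>B\<in>A n. c n B * indicator B p))\<^sup>2) \<partial>lborel) \<longlonglongrightarrow> 0"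
    and A2: "(\<lambda>n. \<integral>\<^sup>+\<omega>. ennreal ((X \<omega> - (\<Sum>B\<in>A n. c n B * W B \<omega>))\<^sup>2) \<partial>M) \<longlonglongrightarrow> 0"
    and [measurable]: "f \<in> borel_measurable borel" "X \<in> borel_measurable M"
    using X unfolding has_wiener_integral_def by blast
  define S where "S n \<omega> = (\<Sum>B\<in>A n. c n B * W B \<omega>)" for n \<omega>
  define s where "s n p = (\<Sum>B\<in>A n. c n B * indicator B p)" for n p
  have cg: "centered_gaussian M (S n)" for n
    using W A[of n] unfolding white_noise_def centered_gaussian_family_def S_def by blast
  then have [measurable]: "S n \<in> borel_measurable M" for n by (simp add: centered_gaussian_def)
  have [measurable]: "s n \<in> borel_measurable borel" for n
    unfolding s_def using A[of n]
    by (intro borel_measurable_sum borel_measurable_times borel_measurable_indicator)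
       (auto simp: noise_sets_def)
  have sp[measurable]: "spacetime \<in> sets borel"
    unfolding spacetime_def by (intro borel_closed closed_Times) auto
  have var: "(\<integral>\<^sup>+\<omega>. ennreal ((S n \<omega>)\<^sup>2) \<partial>M) = (\<integral>\<^sup>+p\<in>spacetime. ennreal ((s n p)\<^sup>2) \<partial>lborel)" for n
    unfolding S_def s_def using A[of n] by (intro white_noise_simple_isometry[OF W]) auto
  \<comment> \<open>The simple functions eventually satisfy \<open>\<integral> (s n)\<^sup>2 \<le> 2 * v + 2 * v\<close>.\<close>
  have sqb: "ennreal (y\<^sup>2) \<le> 2 * ennreal (x\<^sup>2) + 2 * ennreal ((x - y)\<^sup>2)" for x y
  proof -
    have "2 * x\<^sup>2 + 2 * (x - y)\<^sup>2 - y\<^sup>2 = (2 * x - y)\<^sup>2"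
      by (simp add: power2_eq_square algebra_simps)
    then have "y\<^sup>2 \<le> 2 * x\<^sup>2 + 2 * (x - y)\<^sup>2"
      using zero_le_power2[of "2 * x - y"] by linarith
    then have "ennreal (y\<^sup>2) \<le> ennreal (2 * x\<^sup>2 + 2 * (x - y)\<^sup>2)" by (rule ennreal_leI)
    also have "\<dots> = 2 * ennreal (x\<^sup>2) + 2 * ennreal ((x - y)\<^sup>2)"
      by (simp add: ennreal_mult ennreal_plus)
    finally show ?thesis .
  qed
  have vb: "(\<integral>\<^sup>+\<omega>. ennreal ((S n \<omega>)\<^sup>2) \<partial>M)
     \<le> 2 * ennreal v + 2 * (\<integral>\<^sup>+p\<in>spacetime. ennreal ((f p - s n p)\<^sup>2) \<partial>lborel)" for n
  proof -
    have "(\<integral>\<^sup>+p\<in>spacetime. ennreal ((s n p)\<^sup>2) \<partial>lborel)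
       \<le> (\<integral>\<^sup>+p. 2 * (ennreal ((f p)\<^sup>2) * indicator spacetime p)
          + 2 * (ennreal ((f p - s n p)\<^sup>2) * indicator spacetime p) \<partial>lborel)"
      using sqb by (intro nn_integral_mono) (auto simp: indicator_def)
    also have "\<dots> = 2 * (\<integral>\<^sup>+p\<in>spacetime. ennreal ((f p)\<^sup>2) \<partial>lborel)
       + 2 * (\<integral>\<^sup>+p\<in>spacetime. ennreal ((f p - s n p)\<^sup>2) \<partial>lborel)"
      by (simp add: nn_integral_add nn_integral_cmult)
    also have "\<dots> \<le> 2 * ennreal v + 2 * (\<integral>\<^sup>+p\<in>spacetime. ennreal ((f p - s n p)\<^sup>2) \<partial>lborel)"
      using v by (intro add_mono mult_left_mono) auto
    finally show ?thesis unfolding var .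
  qed
  have ev1: "\<forall>\<^sub>F n in sequentially. (\<integral>\<^sup>+p\<in>spacetime. ennreal ((f p - s n p)\<^sup>2) \<partial>lborel) < ennreal v"
    using A1 v(2) unfolding s_def by (intro order_tendstoD) auto
  have cheb: "measure M {\<omega>\<in>space M. \<bar>X \<omega> - S n \<omega>\<bar> > l/2} \<le> \<epsilon>"
    if "(\<integral>\<^sup>+\<omega>. ennreal ((X \<omega> - S n \<omega>)\<^sup>2) \<partial>M) < ennreal (\<epsilon> * (l/2)\<^sup>2)" "\<epsilon> > 0" for n \<epsilon>
  proof -
    have "emeasure M {\<omega>\<in>space M. \<bar>X \<omega> - S n \<omega>\<bar> > l/2} * ennreal ((l/2)\<^sup>2)
        = (\<integral>\<^sup>+\<omega>. ennreal ((l/2)\<^sup>2) * indicator {\<omega>\<in>space M. \<bar>X \<omega> - S n \<omega>\<bar> > l/2} \<omega> \<partial>M)"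
      by (subst nn_integral_cmult_indicator) (simp_all only: mult.commute, measurable)
    also have "\<dots> \<le> (\<integral>\<^sup>+\<omega>. ennreal ((X \<omega> - S n \<omega>)\<^sup>2) \<partial>M)"
    proof (rule nn_integral_mono)
      fix \<omega>
      have "\<bar>X \<omega> - S n \<omega>\<bar> > l/2 \<Longrightarrow> (l/2)\<^sup>2 \<le> (X \<omega> - S n \<omega>)\<^sup>2"
        using l by (metis abs_le_square_iff abs_of_pos half_gt_zero less_imp_le)
      then show "ennreal ((l/2)\<^sup>2) * indicator {\<omega>\<in>space M. \<bar>X \<omega> - S n \<omega>\<bar> > l/2} \<omega> \<le> ennreal ((X \<omega> - S n \<omega>)\<^sup>2)"
        by (auto simp: indicator_def intro!: ennreal_leI)
    qed
    also have "\<dots> < ennreal (\<epsilon> * (l/2)\<^sup>2)" by (rule that)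
    finally have "ennreal (measure M {\<omega>\<in>space M. \<bar>X \<omega> - S n \<omega>\<bar> > l/2} * (l/2)\<^sup>2) < ennreal (\<epsilon> * (l/2)\<^sup>2)"
      by (simp add: emeasure_eq_measure ennreal_mult)
    then have "measure M {\<omega>\<in>space M. \<bar>X \<omega> - S n \<omega>\<bar> > l/2} * (l/2)\<^sup>2 < \<epsilon> * (l/2)\<^sup>2"
      using that by (subst (asm) ennreal_less_iff) auto
    then show ?thesis using l by (auto simp: mult_less_cancel_right)
  qed
  show ?thesis
  proof (rule field_le_epsilon)
    fix \<epsilon> :: real assume \<epsilon>: "\<epsilon> > 0"
    then have "\<forall>\<^sub>F n in sequentially. (\<integral>\<^sup>+\<omega>. ennreal ((X \<omega> - S n \<omega>)\<^sup>2) \<partial>M) < ennreal (\<epsilon> * (l/2)\<^sup>2)"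
      using A2 l unfolding S_def by (intro order_tendstoD) auto
    from eventually_happens'[OF sequentially_bot eventually_conj[OF ev1 this]]
    obtain n where n1: "(\<integral>\<^sup>+p\<in>spacetime. ennreal ((f p - s n p)\<^sup>2) \<partial>lborel) < ennreal v"
      and n2: "(\<integral>\<^sup>+\<omega>. ennreal ((X \<omega> - S n \<omega>)\<^sup>2) \<partial>M) < ennreal (\<epsilon> * (l/2)\<^sup>2)" by auto
    have "(\<integral>\<^sup>+\<omega>. ennreal ((S n \<omega>)\<^sup>2) \<partial>M) \<le> 2 * ennreal v + 2 * ennreal v"
      using n1 by (intro order_trans[OF vb] add_mono mult_left_mono) auto
    also have "\<dots> = ennreal (4 * v)"
      using v(2) by (simp add: ennreal_mult distrib_right[symmetric])
    finally have t: "measure M {\<omega>\<in>space M. \<bar>S n \<omega>\<bar> > l/2} \<le> 2 * exp (- ((l/2)\<^sup>2 / (4 * (4 * v))))"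
      using v(2) l by (intro centered_gaussian_abs_tail[OF M cg]) auto
    have "measure M {\<omega>\<in>space M. \<bar>X \<omega>\<bar> > l}
       \<le> measure M ({\<omega>\<in>space M. \<bar>S n \<omega>\<bar> > l/2} \<union> {\<omega>\<in>space M. \<bar>X \<omega> - S n \<omega>\<bar> > l/2})"
      by (rule finite_measure_mono) (auto simp: abs_real_def split: if_splits)
    also have "\<dots> \<le> measure M {\<omega>\<in>space M. \<bar>S n \<omega>\<bar> > l/2} + measure M {\<omega>\<in>space M. \<bar>X \<omega> - S n \<omega>\<bar> > l/2}"
      by (rule measure_Un_le) auto
    also have "\<dots> \<le> 2 * exp (- (l\<^sup>2 / (64 * v))) + \<epsilon>"
      using t cheb[OF n2 \<epsilon>] by (simp add: power_divide)
    finally show "measure M {\<omega>\<in>space M. \<bar>X \<omega>\<bar> > l} \<le> 2 * exp (- (l\<^sup>2 / (64 * v))) + \<epsilon>" .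
  qed
qed

section \<open>Fourier transform of the Bessel kernel\<close>

definition bessel_coeff :: "nat \<Rightarrow> real" where
  "bessel_coeff k = (- (1 / 4)) ^ k / (fact k)\<^sup>2"

text \<open>
  The entire function \<open>y \<mapsto> J\<^sub>0 (sqrt y)\<close>, that is \<open>I\<^sub>0 (sqrt (- y))\<close> for negative \<open>y\<close>, so that one formula
  covers all signs of \<open>m\<^sup>2 - a\<^sup>2 / 4\<close>.
\<close>

definition bessel :: "real \<Rightarrow> real" where
  "bessel y = (\<Sum>k. bessel_coeff k * y ^ k)"

lemma bessel_coeff_bound: "\<bar>bessel_coeff k * y ^ k\<bar> \<le> \<bar>y\<bar> ^ k / fact k"
proof -
  have "\<bar>bessel_coeff k * y ^ k\<bar> = (1 / 4) ^ k * (\<bar>y\<bar> ^ k / fact k) * (1 / fact k)"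
    by (simp add: bessel_coeff_def abs_mult power_abs power2_eq_square)
  also have "\<dots> \<le> 1 * (\<bar>y\<bar> ^ k / fact k) * 1"
    by (intro mult_mono) (auto simp: power_le_one divide_le_eq_1 fact_ge_1)
  finally show ?thesis by simp
qed

lemma summable_power_over_fact: "summable (\<lambda>k. (y::real) ^ k / fact k)"
  using summable_exp[of y] by (simp add: field_simps)

lemma summable_bessel: "summable (\<lambda>k. bessel_coeff k * y ^ k)"
  by (rule summable_comparison_test'[OF summable_power_over_fact[of "\<bar>y\<bar>"], of 0])
     (simp add: bessel_coeff_bound)

text \<open>
  The derivative is again an everywhere convergent power series.
\<close>

lemma bessel_C1: "\<exists>B'. (\<forall>y. (bessel has_real_derivative B' y) (at y)) \<and> continuous_on UNIV B'"
proof (intro exI conjI allI)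
  show "(bessel has_real_derivative (\<Sum>n. diffs bessel_coeff n * y ^ n)) (at y)" for y
    unfolding bessel_def[abs_def]
    by (rule termdiffs_strong_converges_everywhere) (rule summable_bessel)
  have s: "summable (\<lambda>n. diffs bessel_coeff n * y ^ n)" for y
    by (rule termdiff_converges_all) (rule summable_bessel)
  have "((\<lambda>y. \<Sum>n. diffs bessel_coeff n * y ^ n) has_real_derivative
      (\<Sum>n. diffs (diffs bessel_coeff) n * y ^ n)) (at y)" for y
    by (rule termdiffs_strong_converges_everywhere) (rule s)
  then show "continuous_on UNIV (\<lambda>y. \<Sum>n. diffs bessel_coeff n * y ^ n)"
    by (intro continuous_at_imp_continuous_on) (auto intro: DERIV_isCont)
qed

lemma continuous_on_bessel [continuous_intros]:
  "continuous_on S f \<Longrightarrow> continuous_on S (\<lambda>x. bessel (f x))"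
proof -
  have "continuous_on UNIV bessel"
    using bessel_C1 by (intro continuous_at_imp_continuous_on) (auto intro: DERIV_isCont)
  then show "continuous_on S f \<Longrightarrow> continuous_on S (\<lambda>x. bessel (f x))"
    by (rule continuous_on_compose2) auto
qed

text \<open>
  A Beta integral. The polynomial \<open>(t\<^sup>2 - x\<^sup>2) ^ (k + 1) * x ^ (2 * j + 1)\<close> vanishes at both
  end points, so the integral of its derivative is zero; this expresses the integral for \<open>(k + 1, j)\<close> by the one
  for \<open>(k, j + 1)\<close>.
\<close>

lemma beta_integral:
  fixes t :: real
  assumes t: "t > 0"
  shows "integral {-t..t} (\<lambda>x. (t\<^sup>2 - x\<^sup>2) ^ k * x ^ (2 * j))
      = 2 * t ^ (2 * (k + j) + 1) * (4 ^ k * fact k * fact (2 * j) * fact (k + j)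
          / (fact j * fact (2 * (k + j) + 1)))"
proof (induction k arbitrary: j)
  case 0
  have d: "((\<lambda>x. x ^ (2 * j + 1) / (2 * j + 1)) has_real_derivative x ^ (2 * j)) (at x within S)" for x :: real and S
  proof -
    have "((\<lambda>x. x ^ (2 * j + 1) / (2 * j + 1)) has_real_derivative
        (real (2 * j + 1) * x ^ (2 * j + 1 - Suc 0)) / (2 * j + 1)) (at x within S)"
      by (intro DERIV_cdivide DERIV_pow)
    then show ?thesis by (simp del: power_Suc)
  qed
  have "((\<lambda>x. x ^ (2 * j)) has_integral (t ^ (2 * j + 1) / (2 * j + 1) - (- t) ^ (2 * j + 1) / (2 * j + 1))) {-t..t}"
    by (rule fundamental_theorem_of_calculus)
       (use t in simp, rule d[unfolded has_real_derivative_iff_has_vector_derivative])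
  then have I: "integral {-t..t} (\<lambda>x. x ^ (2 * j)) = 2 * t ^ (2 * j + 1) / (2 * j + 1)"
    by (simp add: integral_unique)
  have F: "4 ^ 0 * fact 0 * fact (2 * j) * fact (0 + j) / (fact j * fact (2 * (0 + j) + 1)) = 1 / (2 * real j + 1)"
  proof -
    have "fact (2 * (0 + j) + 1) = (2 * real j + 1) * fact (2 * j)" by simp
    then show ?thesis unfolding \<open>fact (2 * (0 + j) + 1) = (2 * real j + 1) * fact (2 * j)\<close> by simp
  qed
  have "integral {-t..t} (\<lambda>x. (t\<^sup>2 - x\<^sup>2) ^ 0 * x ^ (2 * j)) = integral {-t..t} (\<lambda>x. x ^ (2 * j))"
    by simp
  then show ?case unfolding F I by simp
next
  case (Suc k)
  let ?M = "\<lambda>k j. integral {-t..t} (\<lambda>x. (t\<^sup>2 - x\<^sup>2) ^ k * x ^ (2 * j))"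
  \<comment> \<open>The integrand is the derivative of \<open>(t\<^sup>2 - x\<^sup>2) ^ (k + 1) * x ^ (2 * j + 1)\<close>.\<close>
  have "((\<lambda>x. (2 * j + 1) * ((t\<^sup>2 - x\<^sup>2) ^ Suc k * x ^ (2 * j))
        - 2 * (k + 1) * ((t\<^sup>2 - x\<^sup>2) ^ k * x ^ (2 * Suc j))) has_integral
      ((t\<^sup>2 - t\<^sup>2) ^ Suc k * t ^ (2 * j + 1) - (t\<^sup>2 - (- t)\<^sup>2) ^ Suc k * (- t) ^ (2 * j + 1))) {-t..t}"
  proof (rule fundamental_theorem_of_calculus)
    show "-t \<le> t" using t by simp
    fix x assume "x \<in> {-t..t}"
    have "((\<lambda>x. t\<^sup>2 - x\<^sup>2) has_real_derivative - (2 * x)) (at x within {-t..t})"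
      by (auto intro!: derivative_eq_intros)
    from DERIV_mult'[OF DERIV_power_Suc[OF this, of k] DERIV_power_Suc[OF DERIV_ident, of "2 * j"]]
    have "((\<lambda>x. (t\<^sup>2 - x\<^sup>2) ^ Suc k * x ^ Suc (2 * j)) has_real_derivative
       (2 * j + 1) * ((t\<^sup>2 - x\<^sup>2) ^ Suc k * x ^ (2 * j)) - 2 * (k + 1) * ((t\<^sup>2 - x\<^sup>2) ^ k * x ^ (2 * Suc j))) (at x within {-t..t})"
    proof (rule DERIV_cong)
      have alg: "Y * ((1 + real (2 * j)) * (1 * X)) + (1 + real k) * (- (2 * x) * y) * (x * X)
        = real (2 * j + 1) * (Y * X) - real (2 * (k + 1)) * (y * (x * x * X))" for X Y y
        by (simp add: algebra_simps)
      have p: "x ^ (2 * Suc j) = x * x * x ^ (2 * j)" "x ^ Suc (2 * j) = x * x ^ (2 * j)" by simp_all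
      show "(t\<^sup>2 - x\<^sup>2) ^ Suc k * ((1 + real (2 * j)) * (1 * x ^ (2 * j)))
          + (1 + real k) * (- (2 * x) * (t\<^sup>2 - x\<^sup>2) ^ k) * x ^ Suc (2 * j)
        = real (2 * j + 1) * ((t\<^sup>2 - x\<^sup>2) ^ Suc k * x ^ (2 * j)) - real (2 * (k + 1)) * ((t\<^sup>2 - x\<^sup>2) ^ k * x ^ (2 * Suc j))"
        unfolding p by (rule alg)
    qed
    then show "((\<lambda>x. (t\<^sup>2 - x\<^sup>2) ^ Suc k * x ^ (2 * j + 1)) has_vector_derivative
       (2 * j + 1) * ((t\<^sup>2 - x\<^sup>2) ^ Suc k * x ^ (2 * j)) - 2 * (k + 1) * ((t\<^sup>2 - x\<^sup>2) ^ k * x ^ (2 * Suc j))) (at x within {-t..t})"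
      by (simp only: has_real_derivative_iff_has_vector_derivative Suc_eq_plus1[of "2 * j", symmetric])
  qed
  then have "((\<lambda>x. (2 * j + 1) * ((t\<^sup>2 - x\<^sup>2) ^ Suc k * x ^ (2 * j))
        - 2 * (k + 1) * ((t\<^sup>2 - x\<^sup>2) ^ k * x ^ (2 * Suc j))) has_integral 0) {-t..t}" by simp
  moreover have "((\<lambda>x. (2 * j + 1) * ((t\<^sup>2 - x\<^sup>2) ^ Suc k * x ^ (2 * j))
        - 2 * (k + 1) * ((t\<^sup>2 - x\<^sup>2) ^ k * x ^ (2 * Suc j))) has_integral
        ((2 * j + 1) * ?M (Suc k) j - 2 * (k + 1) * ?M k (Suc j))) {-t..t}"
    by (intro has_integral_diff has_integral_mult_right integrable_integral
        integrable_continuous_interval continuous_intros)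
  ultimately have "(2 * j + 1) * ?M (Suc k) j - 2 * (k + 1) * ?M k (Suc j) = 0"
    by (rule has_integral_unique[rotated])
  then have "(2 * real j + 1) * ?M (Suc k) j = 2 * (real k + 1) * ?M k (Suc j)"
    by (simp only: right_minus_eq of_nat_add of_nat_mult of_nat_numeral of_nat_1)
  then have e: "?M (Suc k) j = 2 * (real k + 1) * ?M k (Suc j) / (2 * real j + 1)"
    by (simp add: field_simps)
  have f: "fact (2 * Suc j) = 2 * (real j + 1) * (2 * real j + 1) * fact (2 * j)"
    by (simp add: algebra_simps)
  have g: "fact (Suc j) = (real j + 1) * fact j" "fact (Suc k) = (real k + 1) * fact k" by simp_all
  have h: "k + Suc j = Suc k + j" by simp
  have alg: "2 * r' * (2 * T * (P * K * (2 * u * v * D) * E / (u * J * L))) / v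
      = 2 * T * (4 * P * (r' * K) * D * E / (J * L))"
    if "u \<noteq> 0" "v \<noteq> 0" "J \<noteq> 0" "L \<noteq> 0" for u v r' T P K D E J L :: real
    using that by (simp add: field_simps)
  have "?M (Suc k) j = 2 * (real k + 1) * (2 * t ^ (2 * (Suc k + j) + 1) *
      (4 ^ k * fact k * (2 * (real j + 1) * (2 * real j + 1) * fact (2 * j)) * fact (Suc k + j)
        / ((real j + 1) * fact j * fact (2 * (Suc k + j) + 1)))) / (2 * real j + 1)"
    unfolding e Suc.IH f g(1) h by simp
  also have "\<dots> = 2 * t ^ (2 * (Suc k + j) + 1) *
      (4 * 4 ^ k * ((real k + 1) * fact k) * fact (2 * j) * fact (Suc k + j) / (fact j * fact (2 * (Suc k + j) + 1)))"
    by (rule alg) (simp_all add: add_eq_0_iff_both_eq_0)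
  finally show ?case unfolding g(2) power_Suc[of 4] .
qed

text \<open>
  Multiply the power series of \<open>bessel\<close> and of the cosine by the Cauchy product and integrate term by
  term. The closed form of the Beta integrals turns the \<open>n\<close>-th diagonal into the binomial expansion
  of \<open>(\<kappa> + \<xi>\<^sup>2) ^ n\<close>.
\<close>

lemma integral_bessel_cos:
  assumes t: "t > 0"
  shows "(\<lambda>n. 2 * ((-1) ^ n * (\<kappa> + \<xi>\<^sup>2) ^ n * t ^ (2 * n + 1) / fact (2 * n + 1)))
     sums integral\<^sup>L lborel (\<lambda>x. indicator {-t..t} x * (bessel (\<kappa> * (t\<^sup>2 - x\<^sup>2)) * cos (x * \<xi>)))"
proof -
  define a where "a k x = bessel_coeff k * (\<kappa> * (t\<^sup>2 - x\<^sup>2)) ^ k" for k x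
  define b where "b j x = (-1) ^ j / fact (2 * j) * (x * \<xi>) ^ (2 * j)" for j x
  define c where "c n x = (\<Sum>k\<le>n. a k x * b (n - k) x)" for n x
  define A where "A k = (\<bar>\<kappa>\<bar> * t\<^sup>2) ^ k / fact k" for k
  define B where "B j = (t\<^sup>2 * \<xi>\<^sup>2) ^ j / fact j" for j
  have A0: "0 \<le> A k" and B0: "0 \<le> B k" for k by (auto simp: A_def B_def)
  have sA: "summable A" and sB: "summable B"
    unfolding A_def B_def by (rule summable_power_over_fact)+
  have sAB: "summable (\<lambda>n. \<Sum>k\<le>n. A k * B (n - k))"
    using A0 B0 sA sB by (intro summable_Cauchy_product) simp_all
  have aA: "\<bar>a k x\<bar> \<le> A k" if "x \<in> {-t..t}" for k x
  proof -
    have le: "x\<^sup>2 \<le> t\<^sup>2" by (rule power2_le_iff_abs_le[THEN iffD2]) (use that t in auto)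
    then have "\<bar>t\<^sup>2 - x\<^sup>2\<bar> \<le> t\<^sup>2"
      using zero_le_power2[of x] by (simp only: abs_le_iff) linarith
    then have "\<bar>\<kappa> * (t\<^sup>2 - x\<^sup>2)\<bar> \<le> \<bar>\<kappa>\<bar> * t\<^sup>2"
      unfolding abs_mult by (rule mult_left_mono) auto
    then have "\<bar>\<kappa> * (t\<^sup>2 - x\<^sup>2)\<bar> ^ k / fact k \<le> (\<bar>\<kappa>\<bar> * t\<^sup>2) ^ k / fact k"
      by (intro divide_right_mono power_mono) auto
    then show ?thesis using bessel_coeff_bound[of k "\<kappa> * (t\<^sup>2 - x\<^sup>2)"] by (simp add: a_def A_def)
  qed
  have bB: "\<bar>b j x\<bar> \<le> B j" if "x \<in> {-t..t}" for j x
  proof -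
    have le: "x\<^sup>2 \<le> t\<^sup>2" by (rule power2_le_iff_abs_le[THEN iffD2]) (use that t in auto)
    then have "(x\<^sup>2 * \<xi>\<^sup>2) ^ j \<le> (t\<^sup>2 * \<xi>\<^sup>2) ^ j" by (intro power_mono mult_right_mono le) auto
    moreover have "(fact j :: real) \<le> fact (2 * j)" by (intro fact_mono) auto
    ultimately have "(x\<^sup>2 * \<xi>\<^sup>2) ^ j / fact (2 * j) \<le> (t\<^sup>2 * \<xi>\<^sup>2) ^ j / fact j"
      by (intro frac_le) auto
    then show ?thesis by (simp add: b_def B_def abs_mult power_mult power_mult_distrib)
  qed
  have cAB: "\<bar>c n x\<bar> \<le> (\<Sum>k\<le>n. A k * B (n - k))" if "x \<in> {-t..t}" for n x
    unfolding c_def using A0 aA[OF that] bB[OF that]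
    by (intro order_trans[OF sum_abs] sum_mono) (auto simp: abs_mult intro!: mult_mono)
  have sums: "(\<lambda>n. c n x) sums (bessel (\<kappa> * (t\<^sup>2 - x\<^sup>2)) * cos (x * \<xi>))" if "x \<in> {-t..t}" for x
  proof -
    have "summable (\<lambda>k. norm (a k x))" "summable (\<lambda>k. norm (b k x))"
      using aA[OF that] bB[OF that] sA sB
      by (auto intro: summable_comparison_test'[where N = 0])
    then have "(\<lambda>n. c n x) sums ((\<Sum>k. a k x) * (\<Sum>k. b k x))"
      unfolding c_def by (rule Cauchy_product_sums)
    moreover have "(\<Sum>k. b k x) = cos (x * \<xi>)"
      unfolding b_def using cos_paired[of "x * \<xi>"] by (simp add: sums_iff)
    ultimately show ?thesis by (simp add: a_def bessel_def)
  qed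
  have cc: "continuous_on S (c n)" for S n
    unfolding c_def a_def b_def by (intro continuous_intros)
  have si: "set_integrable lborel {-t..t} (c n)" for n
    by (intro borel_integrable_compact[OF _ cc, unfolded set_integrable_def[symmetric]]) auto
  have Ic: "integral\<^sup>L lborel (\<lambda>x. indicator {-t..t} x * c n x) = integral {-t..t} (c n)" for n
    using set_borel_integral_eq_integral(2)[OF si[of n]] by (simp add: set_lebesgue_integral_def)
  let ?I = "\<lambda>n. 2 * ((-1) ^ n * (\<kappa> + \<xi>\<^sup>2) ^ n * t ^ (2 * n + 1) / fact (2 * n + 1))"
  have Iv: "integral {-t..t} (c n) = ?I n" for n
  proof -
    have "integral {-t..t} (c n)
        = integral {-t..t} (\<lambda>x. \<Sum>k\<le>n. (bessel_coeff k * \<kappa> ^ k * ((-1) ^ (n - k) / fact (2 * (n - k)) * \<xi> ^ (2 * (n - k)))) *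
             ((t\<^sup>2 - x\<^sup>2) ^ k * x ^ (2 * (n - k))))"
      unfolding c_def a_def b_def by (simp add: power_mult_distrib ac_simps)
    also have "\<dots> = (\<Sum>k\<le>n. (bessel_coeff k * \<kappa> ^ k * ((-1) ^ (n - k) / fact (2 * (n - k)) * \<xi> ^ (2 * (n - k)))) *
             integral {-t..t} (\<lambda>x. (t\<^sup>2 - x\<^sup>2) ^ k * x ^ (2 * (n - k))))"
      by (subst integral_sum) (auto intro!: integrable_continuous_interval continuous_intros)
    also have "\<dots> = (\<Sum>k\<le>n. (2 * (-1) ^ n * t ^ (2 * n + 1) / fact (2 * n + 1)) *
          (of_nat (n choose k) * \<kappa> ^ k * (\<xi>\<^sup>2) ^ (n - k)))"
    proof (intro sum.cong refl)
      fix k assume "k \<in> {..n}"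
      then obtain j where n: "n = k + j" by (auto simp: le_iff_add)
      have ch: "real ((k + j) choose k) = fact (k + j) / (fact k * fact j)"
        by (simp add: binomial_fact)
      have p: "(- (1 / 4)) ^ k = ((-1) ^ k / 4 ^ k :: real)"
        by (metis minus_divide_left power_divide)
      show "(bessel_coeff k * \<kappa> ^ k * ((-1) ^ (n - k) / fact (2 * (n - k)) * \<xi> ^ (2 * (n - k)))) *
             integral {-t..t} (\<lambda>x. (t\<^sup>2 - x\<^sup>2) ^ k * x ^ (2 * (n - k)))
          = (2 * (-1) ^ n * t ^ (2 * n + 1) / fact (2 * n + 1)) *
          (of_nat (n choose k) * \<kappa> ^ k * (\<xi>\<^sup>2) ^ (n - k))"
        unfolding n add_diff_cancel_left' beta_integral[OF t] ch bessel_coeff_def p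
        by (simp add: field_simps power_add power2_eq_square power_mult del: fact_Suc)
    qed
    also have "\<dots> = (2 * (-1) ^ n * t ^ (2 * n + 1) / fact (2 * n + 1)) * (\<kappa> + \<xi>\<^sup>2) ^ n"
      by (simp add: sum_distrib_left binomial_ring)
    finally show ?thesis by (simp add: ac_simps)
  qed
  have ptw: "(\<Sum>n. indicator {-t..t} x * c n x) = indicator {-t..t} x * (bessel (\<kappa> * (t\<^sup>2 - x\<^sup>2)) * cos (x * \<xi>))" for x
    using sums[of x] by (cases "x \<in> {-t..t}") (auto simp: sums_iff)
  have "(\<lambda>n. integral\<^sup>L lborel (\<lambda>x. indicator {-t..t} x * c n x)) sums
      integral\<^sup>L lborel (\<lambda>x. \<Sum>n. indicator {-t..t} x * c n x)"
  proof (rule sums_integral)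
    show int: "integrable lborel (\<lambda>x. indicator {-t..t} x * c n x)" for n
      using si[of n] by (simp add: set_integrable_def)
    show "AE x in lborel. summable (\<lambda>n. norm (indicator {-t..t} x * c n x))"
    proof (rule AE_I2)
      fix x show "summable (\<lambda>n. norm (indicator {-t..t} x * c n x))"
      proof (cases "x \<in> {-t..t}")
        case True
        then show ?thesis using cAB[OF True]
          by (intro summable_comparison_test'[OF sAB, of 0]) auto
      qed auto
    qed
    show "summable (\<lambda>n. \<integral>x. norm (indicator {-t..t} x * c n x) \<partial>lborel)"
    proof (rule summable_comparison_test'[OF summable_mult[OF sAB, of "2 * t"], of 0])
      fix n
      have "(\<integral>x. norm (indicator {-t..t} x * c n x) \<partial>lborel)
         \<le> (\<integral>x. indicator {-t..t} x * (\<Sum>k\<le>n. A k * B (n - k)) \<partial>lborel)"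
      proof (rule integral_mono[OF integrable_norm[OF int]])
        show "integrable lborel (\<lambda>x. indicator {-t..t} x * (\<Sum>k\<le>n. A k * B (n - k)))"
          using t by (intro integrable_mult_left integrable_real_indicator) auto
        show "norm (indicator {-t..t} x * c n x) \<le> indicator {-t..t} x * (\<Sum>k\<le>n. A k * B (n - k))" for x
          using cAB[of x n] by (auto simp: indicator_def)
      qed
      also have "\<dots> = 2 * t * (\<Sum>k\<le>n. A k * B (n - k))" using t by simp
      finally show "norm (\<integral>x. norm (indicator {-t..t} x * c n x) \<partial>lborel) \<le> 2 * t * (\<Sum>k\<le>n. A k * B (n - k))"
        by (simp add: integral_nonneg_AE)
    qed
  qed
  then show ?thesis unfolding Ic Iv ptw .
qed

section \<open>Uniqueness for Fourier transforms of integrable functions\<close>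

text \<open>
  The positive and the negative part of \<open>f\<close> have the same Fourier transform, in particular the same
  mass. Unless the mass is zero, both normalise to probability densities with equal characteristic functions,
  and Levy's uniqueness theorem applies.
\<close>

lemma fourier_transform_zero:
  fixes f :: "real \<Rightarrow> real"
  assumes f: "integrable lborel f"
    and ft: "\<And>\<xi>. (\<integral>x. complex_of_real (f x) * exp (- (\<i> * of_real (x * \<xi>))) \<partial>lborel) = 0"
  shows "AE x in lborel. f x = 0"
proof -
  have [measurable]: "f \<in> borel_measurable borel" using f by auto
  define p where "p x = max (f x) 0" for x
  define q where "q x = max (- f x) 0" for x
  have [measurable]: "p \<in> borel_measurable borel" "q \<in> borel_measurable borel"
    unfolding p_def q_def by measurable
  have pq: "f x = p x - q x" and p0: "0 \<le> p x" and q0: "0 \<le> q x" for x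
    by (auto simp: p_def q_def)
  have ip: "integrable lborel p" and iq: "integrable lborel q"
    unfolding p_def q_def using f by (auto intro!: integrable_max)
  have ie: "integrable lborel (\<lambda>x. complex_of_real (g x) * iexp (\<xi> * x))"
    if "integrable lborel g" for g \<xi>
  proof (rule Bochner_Integration.integrable_bound[OF that])
    show "(\<lambda>x. complex_of_real (g x) * iexp (\<xi> * x)) \<in> borel_measurable lborel"
      using that by measurable
  qed (simp add: norm_mult)
  have eq: "(\<integral>x. complex_of_real (p x) * iexp (\<xi> * x) \<partial>lborel)
      = (\<integral>x. complex_of_real (q x) * iexp (\<xi> * x) \<partial>lborel)" for \<xi>
  proof -
    have "(\<integral>x. complex_of_real (p x) * iexp (\<xi> * x) \<partial>lborel)
       - (\<integral>x. complex_of_real (q x) * iexp (\<xi> * x) \<partial>lborel)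
       = (\<integral>x. complex_of_real (p x) * iexp (\<xi> * x) - complex_of_real (q x) * iexp (\<xi> * x) \<partial>lborel)"
      using ie[OF ip] ie[OF iq] by (intro Bochner_Integration.integral_diff[symmetric])
    also have "\<dots> = (\<integral>x. complex_of_real (f x) * exp (- (\<i> * of_real (x * (- \<xi>)))) \<partial>lborel)"
      by (simp add: pq algebra_simps)
    finally show ?thesis using ft[of "- \<xi>"] by simp
  qed
  define c where "c = (\<integral>x. p x \<partial>lborel)"
  have cq: "c = (\<integral>x. q x \<partial>lborel)"
    using eq[of 0] by (simp add: c_def)
  have c0: "0 \<le> c" unfolding c_def using p0 by (intro integral_nonneg_AE) auto
  show ?thesis
  proof (cases "c = 0")
    case True
    have "AE x in lborel. p x = 0"
      using integral_nonneg_eq_0_iff_AE[OF ip] p0 True by (auto simp: c_def)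
    moreover have "AE x in lborel. q x = 0"
      using integral_nonneg_eq_0_iff_AE[OF iq] q0 True by (auto simp: cq)
    ultimately show ?thesis by eventually_elim (simp add: pq)
  next
    case False
    with c0 have c: "c > 0" by simp
    have rd: "real_distribution (density lborel (\<lambda>x. ennreal (g x / c)))"
      if "integrable lborel g" "\<And>x. 0 \<le> g x" "(\<integral>x. g x \<partial>lborel) = c" for g
    proof -
      have [measurable]: "g \<in> borel_measurable borel" using that by auto
      have "(\<integral>\<^sup>+x. ennreal (g x / c) \<partial>lborel) = ennreal (\<integral>x. g x / c \<partial>lborel)"
        using that c by (intro nn_integral_eq_integral) auto
      also have "\<dots> = 1" using that c by simp
      finally have "prob_space (density lborel (\<lambda>x. ennreal (g x / c)))"
        by (intro prob_spaceI) (simp add: emeasure_density)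
      then show ?thesis
        by (auto simp: real_distribution_def real_distribution_axioms_def)
    qed
    have ch: "char (density lborel (\<lambda>x. ennreal (g x / c))) \<xi>
        = (\<integral>x. complex_of_real (g x) * iexp (\<xi> * x) \<partial>lborel) / c"
      if [measurable]: "g \<in> borel_measurable borel" and "\<And>x. 0 \<le> g x" for g \<xi>
    proof -
      have "char (density lborel (\<lambda>x. ennreal (g x / c))) \<xi>
         = (\<integral>x. (g x / c) *\<^sub>R iexp (\<xi> * x) \<partial>lborel)"
        unfolding char_def using that c by (intro integral_density) auto
      also have "\<dots> = (\<integral>x. (complex_of_real (g x) * iexp (\<xi> * x)) / c \<partial>lborel)"
        by (simp add: scaleR_conv_of_real)
      finally show ?thesis by simp
    qed
    have "density lborel (\<lambda>x. ennreal (p x / c)) = density lborel (\<lambda>x. ennreal (q x / c))"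
    proof (rule Levy_uniqueness)
      show "char (density lborel (\<lambda>x. ennreal (p x / c))) = char (density lborel (\<lambda>x. ennreal (q x / c)))"
        by (rule ext) (simp only: ch[OF _ p0] ch[OF _ q0] eq \<open>p \<in> borel_measurable borel\<close> \<open>q \<in> borel_measurable borel\<close>)
    qed (rule rd[OF ip p0 c_def[symmetric]], rule rd[OF iq q0 cq[symmetric]])
    then have "AE x in lborel. ennreal (p x / c) = ennreal (q x / c)"
      by (subst (asm) sigma_finite_measure.density_unique_iff[OF sigma_finite_lborel]) auto
    then show ?thesis
    proof eventually_elim
      case (elim x)
      then show ?case using c p0[of x] q0[of x] by (auto simp: pq)
    qed
  qed
qed

section \<open>The fundamental solution in closed form\<close>

definition kg_kernel :: "real \<Rightarrow> real \<Rightarrow> real \<Rightarrow> real \<Rightarrow> real" where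
  "kg_kernel a m t x = (if \<bar>x\<bar> < t then exp (- a * t / 2) / 2 * bessel ((m\<^sup>2 - a\<^sup>2 / 4) * (t\<^sup>2 - x\<^sup>2)) else 0)"

lemma borel_measurable_bessel [measurable]: "bessel \<in> borel_measurable borel"
  using continuous_on_bessel[OF continuous_on_id] by (intro borel_measurable_continuous_onI) auto

lemma borel_measurable_kg_kernel [measurable]:
  assumes [measurable]: "f \<in> borel_measurable N" "g \<in> borel_measurable N"
  shows "(\<lambda>x. kg_kernel a m (f x) (g x)) \<in> borel_measurable N"
  unfolding kg_kernel_def by measurable

lemma sin_sqrt_series:
  fixes t \<mu> :: real
  assumes "\<mu> > 0"
  shows "(\<lambda>n. (-1) ^ n * \<mu> ^ n * t ^ (2 * n + 1) / fact (2 * n + 1)) sums (sin (t * sqrt \<mu>) / sqrt \<mu>)"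
proof -
  define s where "s = sqrt \<mu>"
  have s: "s > 0" "s\<^sup>2 = \<mu>" using assms by (simp_all add: s_def)
  have "(\<lambda>n. ((-1) ^ n / fact (2 * n + 1) * (t * s) ^ (2 * n + 1)) / s) sums (sin (t * s) / s)"
    by (intro sums_divide sin_paired)
  moreover have "((-1) ^ n / fact (2 * n + 1) * (t * s) ^ (2 * n + 1)) / s
       = (-1) ^ n * \<mu> ^ n * t ^ (2 * n + 1) / fact (2 * n + 1)" for n
  proof -
    have "(t * s) ^ (2 * n + 1) = t ^ (2 * n + 1) * (\<mu> ^ n * s)"
      by (simp add: power_mult_distrib power_mult s(2) del: fact_Suc)
    then show ?thesis unfolding \<open>(t * s) ^ (2 * n + 1) = t ^ (2 * n + 1) * (\<mu> ^ n * s)\<close>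
      using s(1) by (simp only: times_divide_eq_left times_divide_eq_right) (simp add: field_simps del: fact_Suc power_Suc)
  qed
  ultimately show ?thesis by (simp only: s_def)
qed

lemma sinh_sqrt_series:
  fixes t \<mu> :: real
  assumes "\<mu> < 0"
  shows "(\<lambda>n. (-1) ^ n * \<mu> ^ n * t ^ (2 * n + 1) / fact (2 * n + 1)) sums (sinh (t * sqrt (- \<mu>)) / sqrt (- \<mu>))"
proof -
  define s where "s = sqrt (- \<mu>)"
  have s: "s > 0" "s\<^sup>2 = - \<mu>" using assms by (simp_all add: s_def)
  let ?f = "\<lambda>n. if even n then 0 else (t * s) ^ n /\<^sub>R fact n"
  have mono: "strict_mono (\<lambda>n::nat. 2 * n + 1)" by (rule strict_monoI) auto
  have z: "?f n = 0" if "n \<notin> range (\<lambda>n. 2 * n + 1)" for n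
    using that by (auto elim!: oddE)
  have "(\<lambda>n. ?f (2 * n + 1)) sums sinh (t * s)"
    using sums_mono_reindex[OF mono, of ?f, OF z] sinh_converges[of "t * s"] by blast
  then have "(\<lambda>n. ?f (2 * n + 1) / s) sums (sinh (t * s) / s)"
    by (rule sums_divide)
  moreover have "?f (2 * n + 1) / s = (-1) ^ n * \<mu> ^ n * t ^ (2 * n + 1) / fact (2 * n + 1)" for n
  proof -
    have e: "(t * s) ^ (2 * n + 1) = t ^ (2 * n + 1) * ((-1) ^ n * \<mu> ^ n * s)"
      unfolding power_mult_distrib by (simp add: power_mult s(2) power_minus[of \<mu>] del: fact_Suc)
    have "?f (2 * n + 1) = (t * s) ^ (2 * n + 1) / fact (2 * n + 1)"
      by (simp add: divide_inverse del: fact_Suc power_Suc)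
    then show ?thesis unfolding e
      using s(1) by (simp only: times_divide_eq_left times_divide_eq_right) (simp add: field_simps del: fact_Suc power_Suc)
  qed
  ultimately show ?thesis by (simp only: s_def)
qed

text \<open>
  The three cases in the definition of the transform are one entire function
  of \<open>\<xi>\<^sup>2 + m\<^sup>2 - a\<^sup>2 / 4\<close>.
\<close>

lemma G_hat_series:
  "(\<lambda>n. exp (- a * t / 2) * ((-1) ^ n * (m\<^sup>2 - a\<^sup>2 / 4 + \<xi>\<^sup>2) ^ n * t ^ (2 * n + 1) / fact (2 * n + 1)))
     sums G_hat a m t \<xi>"
proof -
  define \<mu> where "\<mu> = m\<^sup>2 - a\<^sup>2 / 4 + \<xi>\<^sup>2"
  have r: "\<xi>\<^sup>2 + m\<^sup>2 - a\<^sup>2 / 4 = \<mu>" "a\<^sup>2 / 4 - m\<^sup>2 - \<xi>\<^sup>2 = - \<mu>" by (simp_all add: \<mu>_def)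
  have c: "\<xi>\<^sup>2 > a\<^sup>2 / 4 - m\<^sup>2 \<longleftrightarrow> \<mu> > 0" "\<xi>\<^sup>2 = a\<^sup>2 / 4 - m\<^sup>2 \<longleftrightarrow> \<mu> = 0"
    by (auto simp: \<mu>_def)
  consider "\<mu> > 0" | "\<mu> = 0" | "\<mu> < 0" by linarith
  then have "(\<lambda>n. (-1) ^ n * \<mu> ^ n * t ^ (2 * n + 1) / fact (2 * n + 1)) sums
     (if \<mu> > 0 then sin (t * sqrt \<mu>) / sqrt \<mu> else if \<mu> = 0 then t else sinh (t * sqrt (- \<mu>)) / sqrt (- \<mu>))"
  proof cases
    case 1
    then show ?thesis using sin_sqrt_series[of \<mu> t] by simp
  next
    case 2
    have "(\<lambda>n. (-1) ^ n * \<mu> ^ n * t ^ (2 * n + 1) / fact (2 * n + 1)) sums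
        (\<Sum>n\<in>{0}. (-1) ^ n * \<mu> ^ n * t ^ (2 * n + 1) / fact (2 * n + 1))"
      by (rule sums_finite) (simp_all add: 2)
    with 2 show ?thesis by simp
  next
    case 3
    then show ?thesis using sinh_sqrt_series[of \<mu> t] by simp
  qed
  from sums_mult[OF this, of "exp (- a * t / 2)"] show ?thesis
    unfolding G_hat_def r c by (auto simp: \<mu>_def[symmetric] mult.commute[of t] split: if_splits)
qed

lemma kg_kernel_integrable:
  assumes g: "continuous_on UNIV g"
  shows "integrable lborel (\<lambda>x. kg_kernel a m t x * (g x :: real))"
proof -
  have "set_integrable lborel {-t..t} (\<lambda>x. exp (- a * t / 2) / 2 * bessel ((m\<^sup>2 - a\<^sup>2 / 4) * (t\<^sup>2 - x\<^sup>2)) * g x)"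
    unfolding set_integrable_def
    by (intro borel_integrable_compact continuous_intros continuous_on_subset[OF g]) auto
  then have "set_integrable lborel {-t<..<t} (\<lambda>x. exp (- a * t / 2) / 2 * bessel ((m\<^sup>2 - a\<^sup>2 / 4) * (t\<^sup>2 - x\<^sup>2)) * g x)"
    by (rule set_integrable_subset) auto
  then show ?thesis
    unfolding set_integrable_def
    by (rule Bochner_Integration.integrable_cong[THEN iffD1, rotated -1])
       (auto simp: kg_kernel_def indicator_def)
qed

text \<open>
  The kernel is even, so only the cosine part survives, and its series agrees with that of the
  transform.
\<close>

lemma kg_kernel_fourier:
  assumes t: "t > 0"
  shows "(\<integral>x. complex_of_real (kg_kernel a m t x) * exp (- (\<i> * of_real (x * \<xi>))) \<partial>lborel)
    = complex_of_real (G_hat a m t \<xi>)"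
proof -
  let ?\<kappa> = "m\<^sup>2 - a\<^sup>2 / 4"
  have ic: "integrable lborel (\<lambda>x. kg_kernel a m t x * cos (x * \<xi>))"
    and isn: "integrable lborel (\<lambda>x. kg_kernel a m t x * sin (x * \<xi>))"
    by (intro kg_kernel_integrable continuous_intros)+
  have odd: "(\<integral>x. kg_kernel a m t x * sin (x * \<xi>) \<partial>lborel) = 0"
  proof -
    have "(\<integral>x. kg_kernel a m t x * sin (x * \<xi>) \<partial>lborel)
       = \<bar>-1\<bar> *\<^sub>R (\<integral>x. kg_kernel a m t (0 + (-1) * x) * sin ((0 + (-1) * x) * \<xi>) \<partial>lborel)"
      by (rule lborel_integral_real_affine) simp
    also have "\<dots> = - (\<integral>x. kg_kernel a m t x * sin (x * \<xi>) \<partial>lborel)"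
    proof -
      have "kg_kernel a m t (0 + (-1) * x) * sin ((0 + (-1) * x) * \<xi>) = - (kg_kernel a m t x * sin (x * \<xi>))" for x
        by (simp add: kg_kernel_def)
      then show ?thesis by (simp only: integral_minus) simp
    qed
    finally show ?thesis by simp
  qed
  have "AE x in lborel. x \<noteq> t" "AE x in lborel. x \<noteq> -t"
    by (rule AE_lborel_singleton)+
  then have ae: "AE x in lborel. kg_kernel a m t x * cos (x * \<xi>)
      = exp (- a * t / 2) / 2 * (indicator {-t..t} x * (bessel (?\<kappa> * (t\<^sup>2 - x\<^sup>2)) * cos (x * \<xi>)))"
    by eventually_elim (auto simp: kg_kernel_def indicator_def)
  let ?J = "integral\<^sup>L lborel (\<lambda>x. indicator {-t..t} x * (bessel (?\<kappa> * (t\<^sup>2 - x\<^sup>2)) * cos (x * \<xi>)))"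
  have "(\<integral>x. kg_kernel a m t x * cos (x * \<xi>) \<partial>lborel)
     = (\<integral>x. exp (- a * t / 2) / 2 * (indicator {-t..t} x * (bessel (?\<kappa> * (t\<^sup>2 - x\<^sup>2)) * cos (x * \<xi>))) \<partial>lborel)"
    by (rule integral_cong_AE[OF borel_measurable_integrable[OF ic] _ ae]) measurable
  also have "\<dots> = exp (- a * t / 2) / 2 * ?J" by simp
  also have "\<dots> = G_hat a m t \<xi>"
  proof -
    have "(\<lambda>n. exp (- a * t / 2) / 2 * (2 * ((-1) ^ n * (?\<kappa> + \<xi>\<^sup>2) ^ n * t ^ (2 * n + 1) / fact (2 * n + 1))))
       sums (exp (- a * t / 2) / 2 * ?J)"
      by (intro sums_mult integral_bessel_cos t)
    moreover have "e / 2 * (2 * z) = e * z" for e z :: real by simp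
    ultimately have "(\<lambda>n. exp (- a * t / 2) * ((-1) ^ n * (?\<kappa> + \<xi>\<^sup>2) ^ n * t ^ (2 * n + 1) / fact (2 * n + 1)))
       sums (exp (- a * t / 2) / 2 * ?J)" by (simp only:)
    from sums_unique2[OF this G_hat_series] show ?thesis .
  qed
  finally have co: "(\<integral>x. kg_kernel a m t x * cos (x * \<xi>) \<partial>lborel) = G_hat a m t \<xi>" .
  have ex: "complex_of_real (kg_kernel a m t x) * exp (- (\<i> * of_real (x * \<xi>)))
      = complex_of_real (kg_kernel a m t x * cos (x * \<xi>)) - \<i> * complex_of_real (kg_kernel a m t x * sin (x * \<xi>))" for x
  proof -
    have "exp (- (\<i> * complex_of_real (x * \<xi>))) = cis (- (x * \<xi>))" by (simp add: cis_conv_exp)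
    also have "\<dots> = complex_of_real (cos (x * \<xi>)) - \<i> * complex_of_real (sin (x * \<xi>))"
      by (simp add: complex_eq_iff)
    finally have e: "exp (- (\<i> * complex_of_real (x * \<xi>)))
        = complex_of_real (cos (x * \<xi>)) - \<i> * complex_of_real (sin (x * \<xi>))" .
    show ?thesis unfolding e by (simp add: algebra_simps)
  qed
  have "(\<integral>x. complex_of_real (kg_kernel a m t x) * exp (- (\<i> * of_real (x * \<xi>))) \<partial>lborel)
     = (\<integral>x. complex_of_real (kg_kernel a m t x * cos (x * \<xi>)) \<partial>lborel)
       - (\<integral>x. \<i> * complex_of_real (kg_kernel a m t x * sin (x * \<xi>)) \<partial>lborel)"
    unfolding ex
    by (rule Bochner_Integration.integral_diff)
       (rule integrable_of_real[OF ic], rule integrable_mult_right[OF integrable_of_real[OF isn]])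
  also have "\<dots> = complex_of_real (\<integral>x. kg_kernel a m t x * cos (x * \<xi>) \<partial>lborel)
       - \<i> * complex_of_real (\<integral>x. kg_kernel a m t x * sin (x * \<xi>) \<partial>lborel)"
    by (simp only: integral_complex_of_real integral_mult_right_zero)
  finally have "(\<integral>x. complex_of_real (kg_kernel a m t x) * exp (- (\<i> * of_real (x * \<xi>))) \<partial>lborel)
    = complex_of_real (\<integral>x. kg_kernel a m t x * cos (x * \<xi>) \<partial>lborel)
       - \<i> * complex_of_real (\<integral>x. kg_kernel a m t x * sin (x * \<xi>) \<partial>lborel)" .
  then show ?thesis by (simp only: co odd) simp
qed

lemma fundamental_solution_AE_kg_kernel:
  assumes G: "fundamental_solution a m G" and t: "t > 0"
  shows "AE x in lborel. G t x = kg_kernel a m t x"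
proof -
  have i1: "integrable lborel (G t)"
    and f1: "(\<integral>x. complex_of_real (G t x) * exp (- (\<i> * of_real (x * \<xi>))) \<partial>lborel) = complex_of_real (G_hat a m t \<xi>)" for \<xi>
    using G t by (auto simp: fundamental_solution_def)
  have i2: "integrable lborel (kg_kernel a m t)"
    using kg_kernel_integrable[OF continuous_on_const, of a m t 1] by simp
  have ie: "integrable lborel (\<lambda>x. complex_of_real (g x) * exp (- (\<i> * of_real (x * \<xi>))))"
    if "integrable lborel g" for g \<xi>
  proof (rule Bochner_Integration.integrable_bound[OF that])
    show "(\<lambda>x. complex_of_real (g x) * exp (- (\<i> * of_real (x * \<xi>)))) \<in> borel_measurable lborel"
      using that by measurable
  qed (simp add: norm_mult)
  have "AE x in lborel. G t x - kg_kernel a m t x = 0"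
  proof (rule fourier_transform_zero)
    show "integrable lborel (\<lambda>x. G t x - kg_kernel a m t x)" using i1 i2 by simp
    fix \<xi>
    have "(\<integral>x. complex_of_real (G t x - kg_kernel a m t x) * exp (- (\<i> * of_real (x * \<xi>))) \<partial>lborel)
       = (\<integral>x. complex_of_real (G t x) * exp (- (\<i> * of_real (x * \<xi>)))
           - complex_of_real (kg_kernel a m t x) * exp (- (\<i> * of_real (x * \<xi>))) \<partial>lborel)"
      by (simp add: algebra_simps)
    also have "\<dots> = 0"
      using ie[OF i1] ie[OF i2] f1 kg_kernel_fourier[OF t]
      by (subst Bochner_Integration.integral_diff) auto
    finally show "(\<integral>x. complex_of_real (G t x - kg_kernel a m t x) * exp (- (\<i> * of_real (x * \<xi>))) \<partial>lborel) = 0" .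
  qed
  then show ?thesis by eventually_elim simp
qed

section \<open>Increments of the kernel over light-cone rectangles\<close>

text \<open>
  The kernel inside the light cone as a function of \<open>\<alpha> = t - x\<close> and \<open>\<beta> = t + x\<close>; the Bessel argument is
  governed by \<open>t\<^sup>2 - x\<^sup>2 = \<alpha> * \<beta>\<close>.
\<close>

definition cone_density :: "real \<Rightarrow> real \<Rightarrow> real \<Rightarrow> real \<Rightarrow> real" where
  "cone_density a m \<alpha> \<beta> = exp (- a * (\<alpha> + \<beta>) / 4) / 2 * bessel ((m\<^sup>2 - a\<^sup>2 / 4) * (\<alpha> * \<beta>))"

lemma kg_kernel_light_cone:
  "kg_kernel a m ((\<alpha> + \<beta>) / 2) ((\<beta> - \<alpha>) / 2)
     = (if 0 < \<alpha> \<and> 0 < \<beta> then cone_density a m \<alpha> \<beta> else 0)"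
proof -
  have "\<bar>(\<beta> - \<alpha>) / 2\<bar> < (\<alpha> + \<beta>) / 2 \<longleftrightarrow> 0 < \<alpha> \<and> 0 < \<beta>" by (auto simp: abs_less_iff)
  moreover have "((\<alpha> + \<beta>) / 2)\<^sup>2 - ((\<beta> - \<alpha>) / 2)\<^sup>2 = \<alpha> * \<beta>"
    by (simp add: power2_eq_square field_simps)
  ultimately show ?thesis by (simp add: kg_kernel_def cone_density_def)
qed

lemma cone_density_commute: "cone_density a m \<alpha> \<beta> = cone_density a m \<beta> \<alpha>"
  by (simp add: cone_density_def ac_simps)

text \<open>
  The density is continuously differentiable, hence bounded and Lipschitz on compact squares. By
  symmetry the Lipschitz bound in the first argument also controls the second.
\<close>

lemma cone_density_Lipschitz:
  assumes R: "R > 0"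
  shows "\<exists>\<Lambda>>0. \<forall>\<alpha>\<in>{0..R}. \<forall>\<beta>\<in>{0..R}. \<bar>cone_density a m \<alpha> \<beta>\<bar> \<le> \<Lambda> \<and>
     (\<forall>\<alpha>'\<in>{0..R}. \<bar>cone_density a m \<alpha> \<beta> - cone_density a m \<alpha>' \<beta>\<bar> \<le> \<Lambda> * \<bar>\<alpha> - \<alpha>'\<bar>)"
proof -
  let ?\<kappa> = "m\<^sup>2 - a\<^sup>2 / 4"
  obtain B' where B': "\<And>y. (bessel has_real_derivative B' y) (at y)" and B'c: "continuous_on UNIV B'"
    using bessel_C1 by blast
  define D where "D \<alpha> \<beta> = exp (- a * (\<alpha> + \<beta>) / 4) / 2 * (B' (?\<kappa> * (\<alpha> * \<beta>)) * (?\<kappa> * \<beta>))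
      + (exp (- a * (\<alpha> + \<beta>) / 4) * (- a / 4) / 2) * bessel (?\<kappa> * (\<alpha> * \<beta>))" for \<alpha> \<beta>
  have der: "((\<lambda>\<alpha>. cone_density a m \<alpha> \<beta>) has_real_derivative D \<alpha> \<beta>) (at \<alpha> within S)" for \<alpha> \<beta> S
  proof -
    have 1: "((\<lambda>\<alpha>. exp (- a * (\<alpha> + \<beta>) / 4) / 2) has_real_derivative exp (- a * (\<alpha> + \<beta>) / 4) * (- a / 4) / 2) (at \<alpha>)"
      by (auto intro!: derivative_eq_intros simp: field_simps)
    have 2: "((\<lambda>\<alpha>. ?\<kappa> * (\<alpha> * \<beta>)) has_real_derivative ?\<kappa> * \<beta>) (at \<alpha>)"
      by (auto intro!: derivative_eq_intros)
    show ?thesis unfolding cone_density_def D_def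
      by (rule has_field_derivative_at_within[OF DERIV_mult'[OF 1 DERIV_chain2[OF B' 2]]])
  qed
  have Dc: "continuous_on ({0..R} \<times> {0..R}) (\<lambda>(\<alpha>, \<beta>). D \<alpha> \<beta>)"
    unfolding D_def case_prod_unfold
    by (intro continuous_intros continuous_on_compose2[OF B'c]) auto
  have Cc: "continuous_on ({0..R} \<times> {0..R}) (\<lambda>(\<alpha>, \<beta>). cone_density a m \<alpha> \<beta>)"
    unfolding cone_density_def case_prod_unfold by (intro continuous_intros) auto
  have bd: "\<exists>K>0. \<forall>\<alpha>\<in>{0..R}. \<forall>\<beta>\<in>{0..R}. \<bar>f \<alpha> \<beta>\<bar> \<le> K"
    if "continuous_on ({0..R} \<times> {0..R}) (\<lambda>(\<alpha>, \<beta>). f \<alpha> \<beta>)" for f :: "real \<Rightarrow> real \<Rightarrow> real"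
  proof -
    have "bounded ((\<lambda>(\<alpha>, \<beta>). f \<alpha> \<beta>) ` ({0..R} \<times> {0..R}))"
      by (intro compact_imp_bounded compact_continuous_image that compact_Times) auto
    then obtain K where K: "K > 0" "\<forall>x\<in>(\<lambda>(\<alpha>, \<beta>). f \<alpha> \<beta>) ` ({0..R} \<times> {0..R}). norm x \<le> K"
      unfolding bounded_pos by blast
    show ?thesis
    proof (intro exI[of _ K] conjI ballI)
      fix \<alpha> \<beta> assume "\<alpha> \<in> {0..R}" "\<beta> \<in> {0..R}"
      then have "(\<lambda>(\<alpha>, \<beta>). f \<alpha> \<beta>) (\<alpha>, \<beta>) \<in> (\<lambda>(\<alpha>, \<beta>). f \<alpha> \<beta>) ` ({0..R} \<times> {0..R})"
        by (intro imageI) simp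
      from bspec[OF K(2) this] show "\<bar>f \<alpha> \<beta>\<bar> \<le> K" by simp
    qed (rule K(1))
  qed
  obtain K1 where K1: "K1 > 0" "\<And>\<alpha> \<beta>. \<alpha> \<in> {0..R} \<Longrightarrow> \<beta> \<in> {0..R} \<Longrightarrow> \<bar>cone_density a m \<alpha> \<beta>\<bar> \<le> K1"
    using bd[OF Cc] by blast
  obtain K2 where K2: "K2 > 0" "\<And>\<alpha> \<beta>. \<alpha> \<in> {0..R} \<Longrightarrow> \<beta> \<in> {0..R} \<Longrightarrow> \<bar>D \<alpha> \<beta>\<bar> \<le> K2"
    using bd[OF Dc] by blast
  have lip: "\<bar>cone_density a m \<alpha> \<beta> - cone_density a m \<alpha>' \<beta>\<bar> \<le> K2 * \<bar>\<alpha> - \<alpha>'\<bar>"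
    if "\<alpha> \<in> {0..R}" "\<alpha>' \<in> {0..R}" "\<beta> \<in> {0..R}" for \<alpha> \<alpha>' \<beta>
    using field_differentiable_bound[of "{0..R}" "\<lambda>\<alpha>. cone_density a m \<alpha> \<beta>" "\<lambda>\<alpha>. D \<alpha> \<beta>" K2 \<alpha> \<alpha>']
      that der K2 by auto
  show ?thesis
  proof (intro exI[of _ "K1 + K2"] conjI ballI)
    fix \<alpha> \<beta> assume "\<alpha> \<in> {0..R}" "\<beta> \<in> {0..R}"
    then show "\<bar>cone_density a m \<alpha> \<beta>\<bar> \<le> K1 + K2" using K1(2)[of \<alpha> \<beta>] K2(1) by linarith
    fix \<alpha>' assume a': "\<alpha>' \<in> {0..R}"
    have "K2 * \<bar>\<alpha> - \<alpha>'\<bar> \<le> (K1 + K2) * \<bar>\<alpha> - \<alpha>'\<bar>"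
      using K1(1) by (intro mult_right_mono) auto
    then show "\<bar>cone_density a m \<alpha> \<beta> - cone_density a m \<alpha>' \<beta>\<bar> \<le> (K1 + K2) * \<bar>\<alpha> - \<alpha>'\<bar>"
      using lip[OF \<open>\<alpha> \<in> _\<close> a' \<open>\<beta> \<in> _\<close>] by linarith
  qed (use K1 K2 in auto)
qed

text \<open>
  The integrand of the mild solution at the point with light-cone coordinates \<open>q = t - x\<close> and \<open>p = t + x\<close>,
  with \<open>G\<close> replaced by its closed form. The condition \<open>s < t\<close> is implied by the support of \<open>kg_kernel\<close>. All real
  \<open>q\<close> and \<open>p\<close> are admitted: for \<open>q + p \<le> 0\<close> the kernel vanishes.
\<close>

definition cone_kernel :: "real \<Rightarrow> real \<Rightarrow> real \<Rightarrow> real \<Rightarrow> real \<times> real \<Rightarrow> real" where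
  "cone_kernel a m q p = (\<lambda>(s, y). if 0 \<le> s then kg_kernel a m ((q + p) / 2 - s) ((p - q) / 2 - y) else 0)"

lemma cone_kernel_eq:
  "cone_kernel a m q p (s, y) = (if 0 \<le> s \<and> s - y < q \<and> s + y < p
      then cone_density a m (q - (s - y)) (p - (s + y)) else 0)"
proof -
  have "kg_kernel a m ((q + p) / 2 - s) ((p - q) / 2 - y)
     = kg_kernel a m (((q - (s - y)) + (p - (s + y))) / 2) (((p - (s + y)) - (q - (s - y))) / 2)"
    by (simp add: field_simps)
  then show ?thesis unfolding cone_kernel_def kg_kernel_light_cone by auto
qed

text \<open>
  Bounding areas slice by slice avoids a change of variables to light-cone coordinates.
\<close>

lemma emeasure_plane_le_slices:
  assumes A: "A \<in> sets (borel :: (real \<times> real) measure)" and cd: "c \<le> d" and l: "0 \<le> l"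
    and out: "\<And>s y. (s, y) \<in> A \<Longrightarrow> s \<in> {c..d}"
    and slice: "\<And>s. s \<in> {c..d} \<Longrightarrow> emeasure lborel {y. (s, y) \<in> A} \<le> ennreal l"
  shows "emeasure lborel A \<le> ennreal ((d - c) * l)"
proof -
  have A': "A \<in> sets (lborel \<Otimes>\<^sub>M (lborel :: real measure))"
    using A unfolding lborel_prod by simp
  have "emeasure lborel A = emeasure (lborel \<Otimes>\<^sub>M (lborel :: real measure)) A"
    by (simp add: lborel_prod)
  also have "\<dots> = (\<integral>\<^sup>+s. emeasure lborel (Pair s -` A) \<partial>lborel)"
    by (rule lborel.emeasure_pair_measure_alt[OF A'])
  also have "\<dots> \<le> (\<integral>\<^sup>+s. ennreal l * indicator {c..d} s \<partial>lborel)"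
  proof (rule nn_integral_mono)
    fix s
    show "emeasure lborel (Pair s -` A) \<le> ennreal l * indicator {c..d} s"
    proof (cases "s \<in> {c..d}")
      case True then show ?thesis using slice[OF True] by (simp add: vimage_def)
    next
      case False
      then have "Pair s -` A = {}" using out by auto
      then show ?thesis by simp
    qed
  qed
  also have "\<dots> = ennreal ((d - c) * l)"
    using cd l by (simp add: nn_integral_cmult_indicator ennreal_mult mult.commute)
  finally show ?thesis .
qed

lemma emeasure_slice_le:
  assumes "S \<subseteq> {c..d}" "d - c \<le> l" "0 \<le> l"
  shows "emeasure lborel S \<le> ennreal (l::real)"
proof -
  have "emeasure lborel S \<le> emeasure lborel {c..d}" using assms by (intro emeasure_mono) auto
  also have "\<dots> \<le> ennreal l" using assms by (cases "c \<le> d") (auto intro: ennreal_leI)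
  finally show ?thesis .
qed

text \<open>
  The point \<open>(s, y)\<close> has the light-cone coordinates \<open>\<sigma> = s - y\<close> and \<open>\<rho> = s + y\<close>, and the kernel at
  \<open>(q, p)\<close> is supported in \<open>\<sigma> < q\<close>, \<open>\<rho> < p\<close>. If \<open>(\<sigma>, \<rho>)\<close> is below both lower corners, all four kernels
  are active and the double difference is at most \<open>2 * \<Lambda>\<close> times either side length, hence its square at most
  \<open>4 * \<Lambda>\<^sup>2\<close> times the area. On a strip along one side two kernels are active and the Lipschitz
  bound gives the length of the other side. On the rectangle itself only one kernel is active.
\<close>

lemma cone_kernel_rectangle_pointwise:
  assumes \<Lambda>: "\<Lambda> > 0" "\<And>\<alpha> \<beta>. \<alpha> \<in> {0..R} \<Longrightarrow> \<beta> \<in> {0..R} \<Longrightarrow> \<bar>cone_density a m \<alpha> \<beta>\<bar> \<le> \<Lambda>"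
    "\<And>\<alpha> \<beta> \<alpha>'. \<alpha> \<in> {0..R} \<Longrightarrow> \<beta> \<in> {0..R} \<Longrightarrow> \<alpha>' \<in> {0..R} \<Longrightarrow>
      \<bar>cone_density a m \<alpha> \<beta> - cone_density a m \<alpha>' \<beta>\<bar> \<le> \<Lambda> * \<bar>\<alpha> - \<alpha>'\<bar>"
    and q: "q \<le> q'" and p: "p \<le> p'" and R: "q' + p' \<le> R" and s: "0 \<le> s"
  shows "(cone_kernel a m q' p' (s, y) - cone_kernel a m q' p (s, y)
        - cone_kernel a m q p' (s, y) + cone_kernel a m q p (s, y))\<^sup>2
     \<le> \<Lambda>\<^sup>2 * (4 * ((q' - q) * (p' - p)) * indicator {z. 0 \<le> fst z \<and> fst z - snd z < q' \<and> fst z + snd z < p'} (s, y)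
       + (p' - p)\<^sup>2 * indicator {z. 0 \<le> fst z \<and> fst z \<le> R \<and> q \<le> fst z - snd z \<and> fst z - snd z < q'} (s, y)
       + (q' - q)\<^sup>2 * indicator {z. 0 \<le> fst z \<and> fst z \<le> R \<and> p \<le> fst z + snd z \<and> fst z + snd z < p'} (s, y)
       + indicator {z. q \<le> fst z - snd z \<and> fst z - snd z < q' \<and> p \<le> fst z + snd z \<and> fst z + snd z < p'} (s, y))"
proof -
  define \<sigma> where "\<sigma> = s - y"
  define \<rho> where "\<rho> = s + y"
  have s2: "\<sigma> + \<rho> = 2 * s" by (simp add: \<sigma>_def \<rho>_def)
  have lip2: "\<bar>cone_density a m \<beta> \<alpha> - cone_density a m \<beta> \<alpha>'\<bar> \<le> \<Lambda> * \<bar>\<alpha> - \<alpha>'\<bar>"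
    if "\<alpha> \<in> {0..R}" "\<beta> \<in> {0..R}" "\<alpha>' \<in> {0..R}" for \<alpha> \<beta> \<alpha>'
    using \<Lambda>(3)[OF that] by (simp add: cone_density_commute[of a m \<beta>])
  have sq: "x\<^sup>2 \<le> \<Lambda>\<^sup>2 * c\<^sup>2" if "\<bar>x\<bar> \<le> \<Lambda> * c" for x c
  proof -
    have "\<bar>x\<bar>\<^sup>2 \<le> (\<Lambda> * c)\<^sup>2" using that by (intro power_mono) auto
    then show ?thesis by (simp add: power_mult_distrib)
  qed
  let ?\<psi> = "cone_density a m"
  have pos: "0 \<le> q' - q" "0 \<le> p' - p" using q p by auto
  define I1 I2 I3 I4 :: real where
    "I1 = indicator {z. 0 \<le> fst z \<and> fst z - snd z < q' \<and> fst z + snd z < p'} (s, y)"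
    and "I2 = indicator {z. 0 \<le> fst z \<and> fst z \<le> R \<and> q \<le> fst z - snd z \<and> fst z - snd z < q'} (s, y)"
    and "I3 = indicator {z. 0 \<le> fst z \<and> fst z \<le> R \<and> p \<le> fst z + snd z \<and> fst z + snd z < p'} (s, y)"
    and "I4 = indicator {z. q \<le> fst z - snd z \<and> fst z - snd z < q' \<and> p \<le> fst z + snd z \<and> fst z + snd z < p'} (s, y)"
  have I0: "0 \<le> 4 * ((q' - q) * (p' - p)) * I1" "0 \<le> (p' - p)\<^sup>2 * I2" "0 \<le> (q' - q)\<^sup>2 * I3" "0 \<le> I4"
    using pos by (auto simp: I1_def I2_def I3_def I4_def indicator_def)
  let ?D = "cone_kernel a m q' p' (s, y) - cone_kernel a m q' p (s, y)
        - cone_kernel a m q p' (s, y) + cone_kernel a m q p (s, y)"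
  let ?B = "4 * ((q' - q) * (p' - p)) * I1 + (p' - p)\<^sup>2 * I2 + (q' - q)\<^sup>2 * I3 + I4"
  have "?D\<^sup>2 \<le> \<Lambda>\<^sup>2 * c \<Longrightarrow> c \<le> ?B \<Longrightarrow> ?D\<^sup>2 \<le> \<Lambda>\<^sup>2 * ?B" for c
    by (erule order_trans) (rule mult_left_mono, simp_all)
  note fin = this
  consider "\<sigma> \<ge> q' \<or> \<rho> \<ge> p'" | "\<sigma> < q" "\<rho> < p" | "q \<le> \<sigma>" "\<sigma> < q'" "\<rho> < p" | "\<sigma> < q" "p \<le> \<rho>" "\<rho> < p'"
    | "q \<le> \<sigma>" "\<sigma> < q'" "p \<le> \<rho>" "\<rho> < p'" by linarith
  then have "?D\<^sup>2 \<le> \<Lambda>\<^sup>2 * ?B"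
  proof cases
    case 1
    then have "?D = 0"
      using q p by (auto simp: cone_kernel_eq \<sigma>_def \<rho>_def)
    then show ?thesis using I0 by (intro fin[of 0]) auto
  next
    case 2
    have D: "?D = (?\<psi> (q' - \<sigma>) (p' - \<rho>) - ?\<psi> (q' - \<sigma>) (p - \<rho>)) - (?\<psi> (q - \<sigma>) (p' - \<rho>) - ?\<psi> (q - \<sigma>) (p - \<rho>))"
      using 2 q p s by (auto simp: cone_kernel_eq \<sigma>_def \<rho>_def)
    have in': "q' - \<sigma> \<in> {0..R}" "p' - \<rho> \<in> {0..R}" "q - \<sigma> \<in> {0..R}" "p - \<rho> \<in> {0..R}"
      using 2 q p R s s2 by auto
    have d1: "\<bar>?D\<bar> \<le> \<Lambda> * (2 * (p' - p))"
    proof -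
      have "\<bar>?\<psi> (q' - \<sigma>) (p' - \<rho>) - ?\<psi> (q' - \<sigma>) (p - \<rho>)\<bar> \<le> \<Lambda> * (p' - p)"
        "\<bar>?\<psi> (q - \<sigma>) (p' - \<rho>) - ?\<psi> (q - \<sigma>) (p - \<rho>)\<bar> \<le> \<Lambda> * (p' - p)"
        using lip2[of "p' - \<rho>" "q' - \<sigma>" "p - \<rho>"] lip2[of "p' - \<rho>" "q - \<sigma>" "p - \<rho>"] in' p by simp_all
      moreover have "\<Lambda> * (2 * (p' - p)) = \<Lambda> * (p' - p) + \<Lambda> * (p' - p)" by simp
      ultimately show ?thesis unfolding D by linarith
    qed
    have d2: "\<bar>?D\<bar> \<le> \<Lambda> * (2 * (q' - q))"
    proof -
      have "\<bar>?\<psi> (q' - \<sigma>) (p' - \<rho>) - ?\<psi> (q - \<sigma>) (p' - \<rho>)\<bar> \<le> \<Lambda> * (q' - q)"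
        "\<bar>?\<psi> (q' - \<sigma>) (p - \<rho>) - ?\<psi> (q - \<sigma>) (p - \<rho>)\<bar> \<le> \<Lambda> * (q' - q)"
        using \<Lambda>(3)[of "q' - \<sigma>" "p' - \<rho>" "q - \<sigma>"] \<Lambda>(3)[of "q' - \<sigma>" "p - \<rho>" "q - \<sigma>"] in' q by simp_all
      moreover have "\<Lambda> * (2 * (q' - q)) = \<Lambda> * (q' - q) + \<Lambda> * (q' - q)" by simp
      ultimately show ?thesis unfolding D by linarith
    qed
    have "\<bar>?D\<bar> * \<bar>?D\<bar> \<le> (\<Lambda> * (2 * (q' - q))) * (\<Lambda> * (2 * (p' - p)))"
      using pos \<Lambda>(1) by (intro mult_mono d1 d2) auto
    moreover have "(\<Lambda> * (2 * X)) * (\<Lambda> * (2 * Y)) = \<Lambda>\<^sup>2 * (4 * (X * Y))" for X Y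
      by (simp add: power2_eq_square)
    ultimately have "?D\<^sup>2 \<le> \<Lambda>\<^sup>2 * (4 * ((q' - q) * (p' - p)))"
      by (simp only: abs_mult_self_eq power2_eq_square[of ?D])
    moreover have "I1 = 1" using 2 q p s by (simp add: I1_def \<sigma>_def \<rho>_def)
    ultimately show ?thesis
      by (intro fin) (assumption, use I0(2-4) in \<open>simp only: mult_1_right; linarith\<close>)
  next
    case 3
    have D: "?D = ?\<psi> (q' - \<sigma>) (p' - \<rho>) - ?\<psi> (q' - \<sigma>) (p - \<rho>)"
      using 3 q p s by (auto simp: cone_kernel_eq \<sigma>_def \<rho>_def)
    have in': "q' - \<sigma> \<in> {0..R}" "p' - \<rho> \<in> {0..R}" "p - \<rho> \<in> {0..R}"
      using 3 q p R s s2 by auto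
    have "\<bar>?D\<bar> \<le> \<Lambda> * (p' - p)"
      unfolding D using lip2[of "p' - \<rho>" "q' - \<sigma>" "p - \<rho>"] in' p by simp
    from sq[OF this] have "?D\<^sup>2 \<le> \<Lambda>\<^sup>2 * (p' - p)\<^sup>2" .
    moreover have "s \<le> R" using 3 s2 R p s by linarith
    then have "I2 = 1" using 3 s by (simp add: I2_def \<sigma>_def)
    ultimately show ?thesis
      by (intro fin) (assumption, use I0(1,3,4) in \<open>simp only: mult_1_right; linarith\<close>)
  next
    case 4
    have D: "?D = ?\<psi> (q' - \<sigma>) (p' - \<rho>) - ?\<psi> (q - \<sigma>) (p' - \<rho>)"
      using 4 q p s by (auto simp: cone_kernel_eq \<sigma>_def \<rho>_def)
    have in': "q' - \<sigma> \<in> {0..R}" "p' - \<rho> \<in> {0..R}" "q - \<sigma> \<in> {0..R}"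
      using 4 q p R s s2 by auto
    have "\<bar>?D\<bar> \<le> \<Lambda> * (q' - q)"
      unfolding D using \<Lambda>(3)[of "q' - \<sigma>" "p' - \<rho>" "q - \<sigma>"] in' q by simp
    from sq[OF this] have "?D\<^sup>2 \<le> \<Lambda>\<^sup>2 * (q' - q)\<^sup>2" .
    moreover have "s \<le> R" using 4 s2 R q s by linarith
    then have "I3 = 1" using 4 s by (simp add: I3_def \<rho>_def)
    ultimately show ?thesis
      by (intro fin) (assumption, use I0(1,2,4) in \<open>simp only: mult_1_right; linarith\<close>)
  next
    case 5
    have D: "?D = ?\<psi> (q' - \<sigma>) (p' - \<rho>)"
      using 5 q p s by (auto simp: cone_kernel_eq \<sigma>_def \<rho>_def)
    have "\<bar>?D\<bar> \<le> \<Lambda> * 1"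
      unfolding D using \<Lambda>(2)[of "q' - \<sigma>" "p' - \<rho>"] 5 R s s2 q p by simp
    from sq[OF this] have "?D\<^sup>2 \<le> \<Lambda>\<^sup>2 * 1" by simp
    moreover have "I4 = 1" using 5 by (simp add: I4_def \<sigma>_def \<rho>_def)
    ultimately show ?thesis
      by (intro fin) (assumption, use I0(1-3) in \<open>simp only: mult_1_right; linarith\<close>)
  qed
  then show ?thesis unfolding I1_def I2_def I3_def I4_def .
qed

text \<open>
  Integrate the pointwise bound. A strip has area proportional to its width, so each strip contributes the
  square of one side times the other; the small rectangle has the right area by itself.
\<close>

lemma cone_kernel_rectangle_L2:
  assumes \<Lambda>: "\<Lambda> > 0" "\<And>\<alpha> \<beta>. \<alpha> \<in> {0..R} \<Longrightarrow> \<beta> \<in> {0..R} \<Longrightarrow> \<bar>cone_density a m \<alpha> \<beta>\<bar> \<le> \<Lambda>"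
    "\<And>\<alpha> \<beta> \<alpha>'. \<alpha> \<in> {0..R} \<Longrightarrow> \<beta> \<in> {0..R} \<Longrightarrow> \<alpha>' \<in> {0..R} \<Longrightarrow>
      \<bar>cone_density a m \<alpha> \<beta> - cone_density a m \<alpha>' \<beta>\<bar> \<le> \<Lambda> * \<bar>\<alpha> - \<alpha>'\<bar>"
    and q: "q \<le> q'" "q' - q \<le> R" and p: "p \<le> p'" "p' - p \<le> R" and R: "q' + p' \<le> R"
  shows "(\<integral>\<^sup>+z\<in>spacetime. ennreal ((cone_kernel a m q' p' z - cone_kernel a m q' p z
        - cone_kernel a m q p' z + cone_kernel a m q p z)\<^sup>2) \<partial>lborel)
     \<le> ennreal (\<Lambda>\<^sup>2 * (6 * R\<^sup>2 + 1) * ((q' - q) * (p' - p)))"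
proof -
  define k where "k = q' - q"
  define h where "h = p' - p"
  have hk: "0 \<le> h" "0 \<le> k" "h \<le> R" "k \<le> R" using q p by (auto simp: h_def k_def)
  then have R0: "0 \<le> R" by linarith
  define E1 :: "(real \<times> real) set" where "E1 = {z. 0 \<le> fst z \<and> fst z - snd z < q' \<and> fst z + snd z < p'}"
  define E2 :: "(real \<times> real) set" where "E2 = {z. 0 \<le> fst z \<and> fst z \<le> R \<and> q \<le> fst z - snd z \<and> fst z - snd z < q'}"
  define E3 :: "(real \<times> real) set" where "E3 = {z. 0 \<le> fst z \<and> fst z \<le> R \<and> p \<le> fst z + snd z \<and> fst z + snd z < p'}"
  define E4 :: "(real \<times> real) set" where "E4 = {z. q \<le> fst z - snd z \<and> fst z - snd z < q' \<and> p \<le> fst z + snd z \<and> fst z + snd z < p'}"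
  note E = E1_def E2_def E3_def E4_def
  have m[measurable]: "E1 \<in> sets borel" "E2 \<in> sets borel" "E3 \<in> sets borel" "E4 \<in> sets borel"
    unfolding E Collect_conj_eq
    by (intro sets.Int borel_open[OF open_Collect_less] borel_closed[OF closed_Collect_le] continuous_intros)+
  have e1: "emeasure lborel E1 \<le> ennreal (R * R)"
  proof -
    have "emeasure lborel E1 \<le> ennreal ((R - 0) * R)"
    proof (rule emeasure_plane_le_slices[OF m(1) R0 R0])
      show "s \<in> {0..R}" if "(s, y) \<in> E1" for s y using that R by (auto simp: E)
      show "emeasure lborel {y. (s, y) \<in> E1} \<le> ennreal R" if "s \<in> {0..R}" for s
        by (rule emeasure_slice_le[of _ "s - q'" "p' - s"]) (use that R R0 in \<open>auto simp: E\<close>)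
    qed
    then show ?thesis by simp
  qed
  have e2: "emeasure lborel E2 \<le> ennreal (R * k)"
  proof -
    have "emeasure lborel E2 \<le> ennreal ((R - 0) * k)"
    proof (rule emeasure_plane_le_slices[OF m(2) R0 hk(2)])
      show "emeasure lborel {y. (s, y) \<in> E2} \<le> ennreal k" if "s \<in> {0..R}" for s
        by (rule emeasure_slice_le[of _ "s - q'" "s - q"]) (use hk in \<open>auto simp: E k_def\<close>)
    qed (auto simp: E)
    then show ?thesis by simp
  qed
  have e3: "emeasure lborel E3 \<le> ennreal (R * h)"
  proof -
    have "emeasure lborel E3 \<le> ennreal ((R - 0) * h)"
    proof (rule emeasure_plane_le_slices[OF m(3) R0 hk(1)])
      show "emeasure lborel {y. (s, y) \<in> E3} \<le> ennreal h" if "s \<in> {0..R}" for s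
        by (rule emeasure_slice_le[of _ "p - s" "p' - s"]) (use hk in \<open>auto simp: E h_def\<close>)
    qed (auto simp: E)
    then show ?thesis by simp
  qed
  have e4: "emeasure lborel E4 \<le> ennreal (h * k)"
  proof -
    have "emeasure lborel E4 \<le> ennreal (((p' + q') / 2 - (p + q) / 2) * min h k)"
    proof (rule emeasure_plane_le_slices[OF m(4)])
      show "(p + q) / 2 \<le> (p' + q') / 2" using q p by simp
      show "0 \<le> min h k" using hk by simp
      show "s \<in> {(p + q) / 2..(p' + q') / 2}" if "(s, y) \<in> E4" for s y
        using that by (auto simp: E)
      \<comment> \<open>The slice is the intersection of an interval of length \<open>h\<close> with one of length \<open>k\<close>.\<close>
      show "emeasure lborel {y. (s, y) \<in> E4} \<le> ennreal (min h k)" for s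
      proof (cases "h \<le> k")
        case True
        then show ?thesis
          by (intro emeasure_slice_le[of _ "p - s" "p' - s"]) (use hk in \<open>auto simp: E h_def\<close>)
      next
        case False
        then show ?thesis
          by (intro emeasure_slice_le[of _ "s - q'" "s - q"]) (use hk in \<open>auto simp: E k_def\<close>)
      qed
    qed
    \<comment> \<open>The slices are nonempty only for \<open>s\<close> in an interval of length \<open>(h + k) / 2\<close>.\<close>
    also have "((p' + q') / 2 - (p + q) / 2) * min h k \<le> max h k * min h k"
      using hk by (intro mult_right_mono) (auto simp: h_def k_def max_def field_simps)
    also have "max h k * min h k = h * k" by (auto simp: max_def min_def)
    finally show ?thesis by (simp add: ennreal_leI)
  qed
  have "(\<integral>\<^sup>+z\<in>spacetime. ennreal ((cone_kernel a m q' p' z - cone_kernel a m q' p z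
        - cone_kernel a m q p' z + cone_kernel a m q p z)\<^sup>2) \<partial>lborel)
     \<le> (\<integral>\<^sup>+z. ennreal (\<Lambda>\<^sup>2) * (ennreal (4 * (k * h)) * indicator E1 z + ennreal (h\<^sup>2) * indicator E2 z
        + ennreal (k\<^sup>2) * indicator E3 z + indicator E4 z) \<partial>lborel)"
  proof (rule nn_integral_mono)
    fix z :: "real \<times> real"
    obtain s y where z: "z = (s, y)" by (cases z)
    show "ennreal ((cone_kernel a m q' p' z - cone_kernel a m q' p z
        - cone_kernel a m q p' z + cone_kernel a m q p z)\<^sup>2) * indicator spacetime z
      \<le> ennreal (\<Lambda>\<^sup>2) * (ennreal (4 * (k * h)) * indicator E1 z + ennreal (h\<^sup>2) * indicator E2 z
        + ennreal (k\<^sup>2) * indicator E3 z + indicator E4 z)"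
    proof (cases "0 \<le> s")
      case True
      have "ennreal ((cone_kernel a m q' p' z - cone_kernel a m q' p z
          - cone_kernel a m q p' z + cone_kernel a m q p z)\<^sup>2) \<le>
        ennreal (\<Lambda>\<^sup>2 * (4 * (k * h) * indicator E1 z + h\<^sup>2 * indicator E2 z
        + k\<^sup>2 * indicator E3 z + indicator E4 z))"
        unfolding z E h_def k_def
        by (intro ennreal_leI cone_kernel_rectangle_pointwise \<Lambda> q p R True)
      also have "\<dots> = ennreal (\<Lambda>\<^sup>2) * (ennreal (4 * (k * h)) * indicator E1 z + ennreal (h\<^sup>2) * indicator E2 z
        + ennreal (k\<^sup>2) * indicator E3 z + indicator E4 z)"
        using hk by (cases "z \<in> E1"; cases "z \<in> E2"; cases "z \<in> E3"; cases "z \<in> E4")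
          (simp_all add: ennreal_mult ennreal_plus)
      finally show ?thesis using True by (simp add: z spacetime_def)
    qed (simp add: z spacetime_def)
  qed
  also have "\<dots> = ennreal (\<Lambda>\<^sup>2) * (ennreal (4 * (k * h)) * emeasure lborel E1 + ennreal (h\<^sup>2) * emeasure lborel E2
        + ennreal (k\<^sup>2) * emeasure lborel E3 + emeasure lborel E4)"
    by (simp add: nn_integral_cmult nn_integral_add)
  also have "\<dots> \<le> ennreal (\<Lambda>\<^sup>2) * (ennreal (4 * (k * h)) * ennreal (R * R) + ennreal (h\<^sup>2) * ennreal (R * k)
        + ennreal (k\<^sup>2) * ennreal (R * h) + ennreal (h * k))"
    by (intro mult_left_mono add_mono e1 e2 e3 e4) auto
  also have "\<dots> = ennreal (\<Lambda>\<^sup>2 * (4 * (k * h) * (R * R) + h\<^sup>2 * (R * k) + k\<^sup>2 * (R * h) + h * k))"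
    using hk R0 by (simp add: ennreal_mult ennreal_plus)
  also have "\<dots> \<le> ennreal (\<Lambda>\<^sup>2 * (6 * R\<^sup>2 + 1) * (k * h))"
  proof (rule ennreal_leI)
    have "h\<^sup>2 * (R * k) \<le> (R * R) * (k * h)"
      using mult_right_mono[OF hk(3), of "h * k * R"] hk R0 by (simp add: power2_eq_square ac_simps)
    moreover have "k\<^sup>2 * (R * h) \<le> (R * R) * (k * h)"
      using mult_right_mono[OF hk(4), of "h * k * R"] hk R0 by (simp add: power2_eq_square ac_simps)
    ultimately have "4 * (k * h) * (R * R) + h\<^sup>2 * (R * k) + k\<^sup>2 * (R * h) + h * k \<le> (6 * R\<^sup>2 + 1) * (k * h)"
      by (simp add: algebra_simps power2_eq_square)
    then show "\<Lambda>\<^sup>2 * (4 * (k * h) * (R * R) + h\<^sup>2 * (R * k) + k\<^sup>2 * (R * h) + h * k) \<le> \<Lambda>\<^sup>2 * (6 * R\<^sup>2 + 1) * (k * h)"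
      by (simp only: mult.assoc) (intro mult_left_mono, auto)
  qed
  finally show ?thesis by (simp add: h_def k_def)
qed

text \<open>
  For each \<open>s\<close> the two integrands agree for almost every \<open>y\<close>; Fubini makes this almost everywhere
  in the plane.
\<close>

lemma mild_kernel_AE_cone_kernel:
  assumes G: "fundamental_solution a m G"
    and f: "(\<lambda>(s, y). if 0 \<le> s \<and> s < (q + p) / 2 then G ((q + p) / 2 - s) ((p - q) / 2 - y) else 0) \<in> borel_measurable borel"
  shows "AE z in lborel. (case z of (s, y) \<Rightarrow> if 0 \<le> s \<and> s < (q + p) / 2 then G ((q + p) / 2 - s) ((p - q) / 2 - y) else 0)
     = cone_kernel a m q p z"
proof -
  let ?t = "(q + p) / 2" and ?x = "(p - q) / 2"
  define F where "F = (\<lambda>(s, y). if 0 \<le> s \<and> s < ?t then G (?t - s) (?x - y) else 0)"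
  have Fm: "F \<in> borel_measurable (lborel \<Otimes>\<^sub>M lborel)"
    using f unfolding F_def lborel_prod by simp
  have Km: "cone_kernel a m q p \<in> borel_measurable (lborel \<Otimes>\<^sub>M lborel)"
    unfolding cone_kernel_def case_prod_unfold by measurable
  have "AE z in lborel \<Otimes>\<^sub>M (lborel :: real measure). F z = cone_kernel a m q p z"
  proof (rule lborel_pair.AE_pair_measure)
    show "{z \<in> space (lborel \<Otimes>\<^sub>M lborel). F z = cone_kernel a m q p z} \<in> sets (lborel \<Otimes>\<^sub>M lborel)"
      by (rule borel_measurable_eq[OF Fm Km])
    show "AE s in lborel. AE y in lborel. F (s, y) = cone_kernel a m q p (s, y)"
    proof (rule AE_I2)
      fix s :: real
      show "AE y in lborel. F (s, y) = cone_kernel a m q p (s, y)"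
      proof (cases "0 \<le> s \<and> s < ?t")
        case True
        then have t: "?t - s > 0" by simp
        have Gm: "G (?t - s) \<in> borel_measurable borel"
          using G t borel_measurable_integrable[of lborel "G (?t - s)"]
          by (auto simp: fundamental_solution_def)
        have "Measurable.pred borel (\<lambda>y. G (?t - s) y = kg_kernel a m (?t - s) y)"
          using Gm by measurable
        from AE_borel_affine[OF _ this fundamental_solution_AE_kg_kernel[OF G t], of "-1" ?x]
        have "AE y in lborel. G (?t - s) (?x + (-1) * y) = kg_kernel a m (?t - s) (?x + (-1) * y)"
          by simp
        then show ?thesis
        proof eventually_elim
          case (elim y)
          then show ?case using True by (simp add: cone_kernel_def F_def)
        qed
      next
        case False
        have "F (s, y) = cone_kernel a m q p (s, y)" for y
        proof (cases "0 \<le> s")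
          case True
          with False have "\<not> \<bar>?x - y\<bar> < ?t - s" using abs_ge_zero[of "?x - y"] by linarith
          with False True show ?thesis by (simp add: cone_kernel_def kg_kernel_def F_def)
        qed (simp add: cone_kernel_def F_def)
        then show ?thesis by simp
      qed
    qed
  qed
  then show ?thesis unfolding lborel_prod F_def .
qed

section \<open>Gaussian tails of the increments of the solution\<close>

text \<open>
  An increment in \<open>p\<close> alone is treated as a rectangle increment whose lower side is \<open>q = - p'\<close>: there
  the kernel vanishes, and the rectangle has bounded width.
\<close>

lemma mild_solution_increment_tails:
  assumes M: "prob_space M" and W: "white_noise M W" and G: "fundamental_solution a m G"
    and u: "mild_solution M W G u" and R: "R > 0"
  defines "v \<equiv> \<lambda>q p. u ((q + p) / 2) ((p - q) / 2)"
  shows "\<exists>c>0. \<forall>q p p'. 0 \<le> q \<longrightarrow> 0 \<le> p \<longrightarrow> p < p' \<longrightarrow> q + p' \<le> R \<longrightarrow>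
     (\<forall>l>0. measure M {\<omega>\<in>space M. \<bar>v q p' \<omega> - v q p \<omega>\<bar> > l} \<le> 2 * exp (- (l\<^sup>2 / (c * (p' - p))))) \<and>
     (\<forall>q' l. q < q' \<longrightarrow> q' + p' \<le> R \<longrightarrow> l > 0 \<longrightarrow>
        measure M {\<omega>\<in>space M. \<bar>v q' p' \<omega> - v q' p \<omega> - v q p' \<omega> + v q p \<omega>\<bar> > l}
          \<le> 2 * exp (- (l\<^sup>2 / (c * ((q' - q) * (p' - p))))))"
proof -
  obtain \<Lambda> where \<Lambda>: "\<Lambda> > 0" "\<And>\<alpha> \<beta>. \<alpha> \<in> {0..R} \<Longrightarrow> \<beta> \<in> {0..R} \<Longrightarrow> \<bar>cone_density a m \<alpha> \<beta>\<bar> \<le> \<Lambda>"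
    "\<And>\<alpha> \<beta> \<alpha>'. \<alpha> \<in> {0..R} \<Longrightarrow> \<beta> \<in> {0..R} \<Longrightarrow> \<alpha>' \<in> {0..R} \<Longrightarrow>
      \<bar>cone_density a m \<alpha> \<beta> - cone_density a m \<alpha>' \<beta>\<bar> \<le> \<Lambda> * \<bar>\<alpha> - \<alpha>'\<bar>"
    using cone_density_Lipschitz[OF R, of a m] by blast
  define f where "f q p = (\<lambda>(s, y). if 0 \<le> s \<and> s < (q + p) / 2 then G ((q + p) / 2 - s) ((p - q) / 2 - y) else 0)"
    for q p
  have vW: "has_wiener_integral M W (f q p) (v q p)" if "0 \<le> q" "0 \<le> p" for q p
  proof -
    have "0 \<le> (q + p) / 2" using that by simp
    then show ?thesis using u unfolding mild_solution_def f_def v_def by blast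
  qed
  have fA: "AE z in lborel. f q p z = cone_kernel a m q p z" if "0 \<le> q" "0 \<le> p" for q p
    using mild_kernel_AE_cone_kernel[OF G, of q p] vW[OF that]
    unfolding has_wiener_integral_def f_def by blast
  define c0 where "c0 = \<Lambda>\<^sup>2 * (6 * R\<^sup>2 + 1)"
  have c0: "c0 > 0" unfolding c0_def using \<Lambda>(1) by (intro mult_pos_pos add_nonneg_pos) auto
  define c where "c = 64 * c0 * (1 + R)"
  have c: "c > 0" unfolding c_def using c0 R by auto
  show ?thesis
  proof (intro exI[of _ c] conjI allI impI c)
    fix q p p' l :: real
    assume q: "0 \<le> q" and p: "0 \<le> p" "p < p'" and qp: "q + p' \<le> R" and l: "l > 0"
    have W1: "has_wiener_integral M W (\<lambda>z. f q p' z + (-1) * f q p z) (\<lambda>\<omega>. v q p' \<omega> + (-1) * v q p \<omega>)"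
      by (intro has_wiener_integral_lincomb[OF W] vW) (use q p in auto)
    have "(\<integral>\<^sup>+z\<in>spacetime. ennreal ((f q p' z + (-1) * f q p z)\<^sup>2) \<partial>lborel)
       = (\<integral>\<^sup>+z\<in>spacetime. ennreal ((cone_kernel a m q p' z - cone_kernel a m q p z
           - cone_kernel a m (-p') p' z + cone_kernel a m (-p') p z)\<^sup>2) \<partial>lborel)"
    proof (rule nn_integral_cong_AE)
      \<comment> \<open>On the side \<open>q = - p'\<close> the support condition \<open>2 * s < q + p\<close> contradicts \<open>0 \<le> s\<close>.\<close>
      have z: "cone_kernel a m (-p') p' z = 0" "cone_kernel a m (-p') p z = 0" for z
        using p by (cases z; auto simp: cone_kernel_eq)+
      have "AE z in lborel. f q p' z = cone_kernel a m q p' z" "AE z in lborel. f q p z = cone_kernel a m q p z"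
        by (rule fA; use q p in simp)+
      then show "AE z in lborel. ennreal ((f q p' z + (-1) * f q p z)\<^sup>2) * indicator spacetime z
        = ennreal ((cone_kernel a m q p' z - cone_kernel a m q p z
           - cone_kernel a m (-p') p' z + cone_kernel a m (-p') p z)\<^sup>2) * indicator spacetime z"
        by eventually_elim (simp add: z)
    qed
    also have "\<dots> \<le> ennreal (c0 * ((q - (-p')) * (p' - p)))"
      unfolding c0_def by (rule cone_kernel_rectangle_L2[OF \<Lambda>]) (use q p qp in auto)
    also have "\<dots> \<le> ennreal (c / 64 * (p' - p))"
    proof (rule ennreal_leI)
      have "c0 * ((q - (-p')) * (p' - p)) \<le> c0 * ((1 + R) * (p' - p))"
        using c0 p qp by (intro mult_left_mono mult_right_mono) auto
      then show "c0 * ((q - (-p')) * (p' - p)) \<le> c / 64 * (p' - p)" by (simp add: c_def)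
    qed
    finally have "measure M {\<omega>\<in>space M. \<bar>v q p' \<omega> + (-1) * v q p \<omega>\<bar> > l}
        \<le> 2 * exp (- (l\<^sup>2 / (64 * (c / 64 * (p' - p)))))"
      using c p by (intro has_wiener_integral_abs_tail[OF M W W1 _ _ l]) auto
    then show "measure M {\<omega>\<in>space M. \<bar>v q p' \<omega> - v q p \<omega>\<bar> > l} \<le> 2 * exp (- (l\<^sup>2 / (c * (p' - p))))"
      by simp
    fix q' l :: real
    assume q': "q < q'" "q' + p' \<le> R" and l: "l > 0"
    have W2: "has_wiener_integral M W (\<lambda>z. ((f q' p' z + (-1) * f q' p z) + (-1) * f q p' z) + 1 * f q p z)
        (\<lambda>\<omega>. ((v q' p' \<omega> + (-1) * v q' p \<omega>) + (-1) * v q p' \<omega>) + 1 * v q p \<omega>)"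
      by (intro has_wiener_integral_lincomb[OF W] vW) (use q p q' in auto)
    have "(\<integral>\<^sup>+z\<in>spacetime. ennreal ((((f q' p' z + (-1) * f q' p z) + (-1) * f q p' z) + 1 * f q p z)\<^sup>2) \<partial>lborel)
       = (\<integral>\<^sup>+z\<in>spacetime. ennreal ((cone_kernel a m q' p' z - cone_kernel a m q' p z
           - cone_kernel a m q p' z + cone_kernel a m q p z)\<^sup>2) \<partial>lborel)"
    proof (rule nn_integral_cong_AE)
      have "AE z in lborel. f q p' z = cone_kernel a m q p' z" "AE z in lborel. f q p z = cone_kernel a m q p z"
        "AE z in lborel. f q' p' z = cone_kernel a m q' p' z" "AE z in lborel. f q' p z = cone_kernel a m q' p z"
        by (rule fA; use q p q' in simp)+
      then show "AE z in lborel. ennreal ((((f q' p' z + (-1) * f q' p z) + (-1) * f q p' z) + 1 * f q p z)\<^sup>2) * indicator spacetime z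
        = ennreal ((cone_kernel a m q' p' z - cone_kernel a m q' p z
           - cone_kernel a m q p' z + cone_kernel a m q p z)\<^sup>2) * indicator spacetime z"
        by eventually_elim simp
    qed
    also have "\<dots> \<le> ennreal (c0 * ((q' - q) * (p' - p)))"
      unfolding c0_def by (rule cone_kernel_rectangle_L2[OF \<Lambda>]) (use q p q' in auto)
    also have "\<dots> \<le> ennreal (c / 64 * ((q' - q) * (p' - p)))"
    proof (rule ennreal_leI)
      have "c0 * ((q' - q) * (p' - p)) \<le> (c0 * (1 + R)) * ((q' - q) * (p' - p))"
        using c0 p q' R by (intro mult_right_mono) auto
      then show "c0 * ((q' - q) * (p' - p)) \<le> c / 64 * ((q' - q) * (p' - p))" by (simp add: c_def)
    qed
    finally have "measure M {\<omega>\<in>space M. \<bar>((v q' p' \<omega> + (-1) * v q' p \<omega>) + (-1) * v q p' \<omega>) + 1 * v q p \<omega>\<bar> > l}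
        \<le> 2 * exp (- (l\<^sup>2 / (64 * (c / 64 * ((q' - q) * (p' - p))))))"
      using c p q' by (intro has_wiener_integral_abs_tail[OF M W W2 _ _ l]) auto
    then show "measure M {\<omega>\<in>space M. \<bar>v q' p' \<omega> - v q' p \<omega> - v q p' \<omega> + v q p \<omega>\<bar> > l}
        \<le> 2 * exp (- (l\<^sup>2 / (c * ((q' - q) * (p' - p)))))"
      by simp
  qed
qed

section \<open>Dyadic chaining on the unit square\<close>

text \<open>
  Rounding both coordinates of a grid point of level \<open>k + 1\<close> down to the grid of level \<open>k\<close> takes at most
  one step in each direction. Following this chain down to the four corners and then to the origin gives a geometric sum.
\<close>

lemma dyadic_chain_bound:
  fixes f :: "real \<Rightarrow> real \<Rightarrow> real" and A q :: real
  assumes q: "0 \<le> q" "q < 1" and A: "0 \<le> A" and f0: "f 0 0 = 0"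
    and hor: "\<And>k i j. i < 2 ^ k \<Longrightarrow> j \<le> 2 ^ k \<Longrightarrow>
        \<bar>f (real (Suc i) / 2 ^ k) (real j / 2 ^ k) - f (real i / 2 ^ k) (real j / 2 ^ k)\<bar> \<le> A * q ^ k"
    and ver: "\<And>k i j. i < 2 ^ k \<Longrightarrow> j \<le> 2 ^ k \<Longrightarrow>
        \<bar>f (real j / 2 ^ k) (real (Suc i) / 2 ^ k) - f (real j / 2 ^ k) (real i / 2 ^ k)\<bar> \<le> A * q ^ k"
    and ij: "i \<le> 2 ^ k" "j \<le> 2 ^ k"
  shows "\<bar>f (real i / 2 ^ k) (real j / 2 ^ k)\<bar> \<le> 2 * A / (1 - q)"
proof -
  have "\<bar>f (real i / 2 ^ k) (real j / 2 ^ k)\<bar> \<le> (\<Sum>l\<le>k. 2 * A * q ^ l)"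
    using ij
  proof (induction k arbitrary: i j)
    case 0
    then have "i \<in> {0, 1}" "j \<in> {0, 1}" by auto
    then show ?case
      using hor[of 0 0 0] hor[of 0 0 1] ver[of 0 0 0] ver[of 0 0 1] f0 A by auto
  next
    case (Suc k)
    let ?i = "2 * (i div 2)" and ?j = "2 * (j div 2)"
    let ?N = "2 ^ Suc k :: real"
    have half: "real (2 * l) / ?N = real l / 2 ^ k" for l by simp
    have st1: "\<bar>f (real i / ?N) (real j / ?N) - f (real ?i / ?N) (real j / ?N)\<bar> \<le> A * q ^ Suc k"
    proof (cases "even i")
      case True then show ?thesis using A q by simp
    next
      case False
      then have i: "i = Suc ?i" by presburger
      then have "?i < 2 ^ Suc k" using Suc.prems by linarith
      then show ?thesis using hor[of ?i "Suc k" j] Suc.prems i by metis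
    qed
    have le: "?i \<le> 2 ^ Suc k" using Suc.prems by linarith
    have st2: "\<bar>f (real ?i / ?N) (real j / ?N) - f (real ?i / ?N) (real ?j / ?N)\<bar> \<le> A * q ^ Suc k"
    proof (cases "even j")
      case True then show ?thesis using A q by simp
    next
      case False
      then have j: "j = Suc ?j" by presburger
      then have "?j < 2 ^ Suc k" using Suc.prems by linarith
      then show ?thesis using ver[of ?j "Suc k" ?i] le j by metis
    qed
    have "\<bar>f (real ?i / ?N) (real ?j / ?N)\<bar> \<le> (\<Sum>l\<le>k. 2 * A * q ^ l)"
      unfolding half using Suc.prems by (intro Suc.IH) auto
    with st1 st2 have "\<bar>f (real i / ?N) (real j / ?N)\<bar> \<le> (\<Sum>l\<le>k. 2 * A * q ^ l) + 2 * (A * q ^ Suc k)"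
      by linarith
    then show ?case by (simp only: sum.atMost_Suc mult.assoc)
  qed
  also have "\<dots> = 2 * A * (\<Sum>l\<le>k. q ^ l)" by (simp add: sum_distrib_left)
  also have "\<dots> \<le> 2 * A * (1 / (1 - q))"
  proof (intro mult_left_mono)
    have "(\<Sum>l\<in>{..k}. q ^ l) \<le> (\<Sum>l. q ^ l)"
      using q by (intro sum_le_suminf summable_geometric) auto
    also have "\<dots> = 1 / (1 - q)" using q by (intro suminf_geometric) auto
    finally show "(\<Sum>l\<le>k. q ^ l) \<le> 1 / (1 - q)" .
  qed (use A in auto)
  finally show ?thesis by simp
qed

lemma dyadic_chain_bound_continuous:
  fixes f :: "real \<Rightarrow> real \<Rightarrow> real" and A q :: real
  assumes q: "0 \<le> q" "q < 1" and A: "0 \<le> A" and f0: "f 0 0 = 0"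
    and hor: "\<And>k i j. i < 2 ^ k \<Longrightarrow> j \<le> 2 ^ k \<Longrightarrow>
        \<bar>f (real (Suc i) / 2 ^ k) (real j / 2 ^ k) - f (real i / 2 ^ k) (real j / 2 ^ k)\<bar> \<le> A * q ^ k"
    and ver: "\<And>k i j. i < 2 ^ k \<Longrightarrow> j \<le> 2 ^ k \<Longrightarrow>
        \<bar>f (real j / 2 ^ k) (real (Suc i) / 2 ^ k) - f (real j / 2 ^ k) (real i / 2 ^ k)\<bar> \<le> A * q ^ k"
    and cont: "continuous_on ({0..1} \<times> {0..1}) (\<lambda>(x, y). f x y)"
    and xy: "x \<in> {0..1}" "y \<in> {0..1}"
  shows "\<bar>f x y\<bar> \<le> 2 * A / (1 - q)"
proof -
  \<comment> \<open>Left end points of the dyadic intervals of level \<open>k\<close> around \<open>z\<close>.\<close>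
  define r where "r z k = real (nat \<lfloor>z * 2 ^ k\<rfloor>)" for z :: real and k :: nat
  have rle: "nat \<lfloor>z * 2 ^ k\<rfloor> \<le> 2 ^ k" if "z \<in> {0..1}" for z :: real and k
  proof -
    have "z * 2 ^ k \<le> 1 * 2 ^ k" using that by (intro mult_right_mono) auto
    then have "\<lfloor>z * 2 ^ k\<rfloor> \<le> 2 ^ k"
      unfolding floor_le_iff by (simp only: of_int_power of_int_numeral)
    then show ?thesis by (simp add: nat_le_iff)
  qed
  have rlim: "(\<lambda>k. r z k / 2 ^ k) \<longlonglongrightarrow> z" if "z \<in> {0..1}" for z
  proof (rule tendsto_sandwich)
    have b: "z * 2 ^ k - 1 \<le> r z k \<and> r z k \<le> z * 2 ^ k" for k
      using that unfolding r_def by (auto simp: of_nat_nat)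
    show "\<forall>\<^sub>F k in sequentially. z - (1 / 2) ^ k \<le> r z k / 2 ^ k"
    proof (rule always_eventually, rule allI)
      fix k
      have "z - (1 / 2) ^ k = (z * 2 ^ k - 1) / 2 ^ k" by (simp add: diff_divide_distrib power_one_over)
      also have "\<dots> \<le> r z k / 2 ^ k" using b[of k] by (intro divide_right_mono) auto
      finally show "z - (1 / 2) ^ k \<le> r z k / 2 ^ k" .
    qed
    show "\<forall>\<^sub>F k in sequentially. r z k / 2 ^ k \<le> z"
      using b by (simp add: divide_le_eq)
    have "(\<lambda>k. z - (1 / 2) ^ k) \<longlonglongrightarrow> z - 0"
      by (intro tendsto_intros LIMSEQ_power_zero) auto
    then show "(\<lambda>k. z - (1 / 2) ^ k) \<longlonglongrightarrow> z" by simp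
  qed auto
  have r01: "r z k / 2 ^ k \<in> {0..1}" if "z \<in> {0..1}" for z k
    using rle[OF that, of k] by (simp add: r_def)
  have "(\<lambda>k. (\<lambda>(x, y). f x y) (r x k / 2 ^ k, r y k / 2 ^ k)) \<longlonglongrightarrow> (\<lambda>(x, y). f x y) (x, y)"
    using xy r01 by (intro continuous_on_tendsto_compose[OF cont] tendsto_Pair rlim) auto
  then have "(\<lambda>k. \<bar>f (r x k / 2 ^ k) (r y k / 2 ^ k)\<bar>) \<longlonglongrightarrow> \<bar>f x y\<bar>"
    by (intro tendsto_rabs) simp
  then show ?thesis
  proof (rule LIMSEQ_le_const2)
    show "\<exists>N. \<forall>n\<ge>N. \<bar>f (r x n / 2 ^ n) (r y n / 2 ^ n)\<bar> \<le> 2 * A / (1 - q)"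
      unfolding r_def using rle xy
      by (intro exI allI impI dyadic_chain_bound[OF q A f0 hor ver]) auto
  qed
qed

text \<open>
  At level \<open>k\<close> the links have variance proxy \<open>C / 2 ^ k\<close> while the thresholds decrease only like
  \<open>(3 / 4) ^ k\<close>, so the exponent grows like \<open>(9 / 8) ^ k \<ge> 1 + k / 8\<close>. The value \<open>L\<^sup>2 = 32 * C\<close> turns this into
  \<open>(32 + 4 * k) * ln n\<close>: the first part is summable in \<open>n\<close>, the second gives \<open>exp (- 4) ^ k \<le> (1 / 16) ^ k\<close> because
  \<open>ln n \<ge> 1\<close> for \<open>n \<ge> 3\<close>, which outweighs the number of links, of order \<open>4 ^ k\<close>.
\<close>

lemma dyadic_link_tail_bound:
  fixes L C :: real
  assumes C: "C > 0" and n: "n \<ge> (3::nat)" and L: "L\<^sup>2 = 32 * C"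
  shows "2 * exp (- ((L * sqrt (ln n) * (3 / 4) ^ k)\<^sup>2 / (C * (1 / 2 ^ k)))) \<le> 2 * (1 / 16) ^ k * (1 / real n ^ 2)"
proof -
  have ln: "ln n \<ge> 1"
  proof -
    have "exp 1 \<le> (3::real)" using exp_le by simp
    also have "\<dots> \<le> n" using n by simp
    finally show ?thesis using n by (subst ln_ge_iff) auto
  qed
  have "(L * sqrt (ln n) * (3 / 4) ^ k)\<^sup>2 / (C * (1 / 2 ^ k)) = 32 * ln n * ((9 / 8) ^ k)"
  proof -
    have "(L * sqrt (ln n) * (3 / 4) ^ k)\<^sup>2 = 32 * C * ln n * (9 / 16) ^ k"
      using ln by (simp add: power_mult_distrib L power_divide power_mult[symmetric] mult.commute[of _ 2])
         (simp add: power_mult)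
    then have "(L * sqrt (ln n) * (3 / 4) ^ k)\<^sup>2 / (C * (1 / 2 ^ k)) = 32 * ln n * ((9 / 16) ^ k * 2 ^ k)"
      using C by (simp only:) (simp add: divide_simps)
    also have "(9 / 16 :: real) ^ k * 2 ^ k = (9 / 8) ^ k"
      by (simp add: power_mult_distrib[symmetric])
    finally show ?thesis .
  qed
  also have "32 * ln n * ((9 / 8) ^ k) \<ge> 32 * ln n * (1 + k * (1 / 8))"
  proof (intro mult_left_mono)
    show "1 + real k * (1 / 8) \<le> (9 / 8) ^ k" using Bernoulli_inequality[of "1 / 8" k] by simp
  qed (use ln in auto)
  finally have e: "(L * sqrt (ln n) * (3 / 4) ^ k)\<^sup>2 / (C * (1 / 2 ^ k)) \<ge> 32 * ln n + 4 * k * ln n"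
    by (simp add: algebra_simps)
  have "exp (- ((L * sqrt (ln n) * (3 / 4) ^ k)\<^sup>2 / (C * (1 / 2 ^ k)))) \<le> exp (- (2 * ln n) - k * 4)"
  proof -
    have "4 * real k * ln n \<ge> 4 * real k * 1" using ln by (intro mult_left_mono) auto
    then show ?thesis using e ln by simp
  qed
  also have "\<dots> = exp (- (2 * ln n)) * exp (-4) ^ k"
    by (simp add: exp_diff exp_of_nat_mult exp_minus power_inverse divide_inverse)
  also have "exp (- (2 * ln n)) = 1 / real n ^ 2"
    using n exp_of_nat_mult[of 2 "ln (real n)"] by (simp add: exp_minus divide_inverse)
  also have "1 / real n ^ 2 * exp (-4) ^ k \<le> 1 / real n ^ 2 * (1 / 16) ^ k"
  proof (intro mult_left_mono power_mono)
    have "(2::real) ^ 4 \<le> exp 1 ^ 4" using exp_ge_add_one_self[of 1] by (intro power_mono) auto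
    also have "\<dots> = exp 4" using exp_of_nat_mult[of 4 "1::real"] by simp
    finally show "exp (-4) \<le> (1 / 16 :: real)" by (simp add: exp_minus field_simps)
  qed auto
  finally show ?thesis by simp
qed

text \<open>
  Borel--Cantelli for the events that some link of the dyadic grids exceeds its threshold; outside of
  them the chain bound applies. The factor is \<open>8 = 2 / (1 - 3 / 4)\<close>.
\<close>

lemma chaining_sqrt_ln_bound:
  fixes Y :: "nat \<Rightarrow> real \<Rightarrow> real \<Rightarrow> 'w \<Rightarrow> real"
  assumes M: "prob_space M" and C: "C > 0"
    and meas: "\<And>n s r. s \<in> {0..1} \<Longrightarrow> r \<in> {0..1} \<Longrightarrow> Y n s r \<in> borel_measurable M"
    and Y0: "\<And>n \<omega>. Y n 0 0 \<omega> = 0"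
    and cont: "AE \<omega> in M. \<forall>n. continuous_on ({0..1} \<times> {0..1}) (\<lambda>(s, r). Y n s r \<omega>)"
    and hor: "\<And>n s s' r l. 0 \<le> s \<Longrightarrow> s < s' \<Longrightarrow> s' \<le> 1 \<Longrightarrow> r \<in> {0..1} \<Longrightarrow> l > 0 \<Longrightarrow>
       measure M {\<omega> \<in> space M. \<bar>Y n s' r \<omega> - Y n s r \<omega>\<bar> > l} \<le> 2 * exp (- (l\<^sup>2 / (C * (s' - s))))"
    and ver: "\<And>n s r r' l. 0 \<le> r \<Longrightarrow> r < r' \<Longrightarrow> r' \<le> 1 \<Longrightarrow> s \<in> {0..1} \<Longrightarrow> l > 0 \<Longrightarrow>
       measure M {\<omega> \<in> space M. \<bar>Y n s r' \<omega> - Y n s r \<omega>\<bar> > l} \<le> 2 * exp (- (l\<^sup>2 / (C * (r' - r))))"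
  shows "AE \<omega> in M. \<forall>\<^sub>F n in sequentially. \<forall>s\<in>{0..1}. \<forall>r\<in>{0..1}.
      \<bar>Y n s r \<omega>\<bar> \<le> 8 * sqrt (32 * C) * sqrt (ln n)"
proof -
  interpret prob_space M by fact
  define L where "L = sqrt (32 * C)"
  have L: "L > 0" "L\<^sup>2 = 32 * C" using C by (auto simp: L_def)
  define th where "th n k = L * sqrt (ln (real n)) * (3 / 4) ^ k" for n k :: nat
  define H where "H n k i j = {\<omega> \<in> space M.
      \<bar>Y n (real (Suc i) / 2 ^ k) (real j / 2 ^ k) \<omega> - Y n (real i / 2 ^ k) (real j / 2 ^ k) \<omega>\<bar> > th n k}"
    for n k i j :: nat
  define V where "V n k i j = {\<omega> \<in> space M.
      \<bar>Y n (real j / 2 ^ k) (real (Suc i) / 2 ^ k) \<omega> - Y n (real j / 2 ^ k) (real i / 2 ^ k) \<omega>\<bar> > th n k}"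
    for n k i j :: nat
  define I where "I k = {..<2 ^ k :: nat} \<times> {..2 ^ k :: nat}" for k :: nat
  define B where "B n k = (\<Union>(i, j)\<in>I k. H n k i j \<union> V n k i j)" for n k
  have pt: "real i / 2 ^ k \<in> {0..1}" if "i \<le> 2 ^ k" for i k :: nat
  proof -
    have "real i \<le> 2 ^ k" using that by (metis of_nat_le_iff of_nat_numeral of_nat_power)
    then show ?thesis by simp
  qed
  have Hs: "H n k i j \<in> sets M" and Vs: "V n k i j \<in> sets M" if "(i, j) \<in> I k" for n k i j
  proof -
    have [measurable]: "Y n (real (Suc i) / 2 ^ k) (real j / 2 ^ k) \<in> borel_measurable M"
      "Y n (real i / 2 ^ k) (real j / 2 ^ k) \<in> borel_measurable M"
      "Y n (real j / 2 ^ k) (real (Suc i) / 2 ^ k) \<in> borel_measurable M"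
      "Y n (real j / 2 ^ k) (real i / 2 ^ k) \<in> borel_measurable M"
      using that by (intro meas pt; simp add: I_def)+
    show "H n k i j \<in> sets M" "V n k i j \<in> sets M"
      unfolding H_def V_def by measurable
  qed
  have fin: "finite (I k)" for k by (simp add: I_def)
  have Bs: "B n k \<in> sets M" for n k
    unfolding B_def using Hs Vs fin by (intro sets.finite_UN) auto
  have thpos: "th n k > 0" if "n \<ge> 3" for n k
    using that L by (simp add: th_def)
  have HV: "measure M (H n k i j) \<le> 2 * (1 / 16) ^ k * (1 / real n ^ 2)"
    "measure M (V n k i j) \<le> 2 * (1 / 16) ^ k * (1 / real n ^ 2)"
    if "(i, j) \<in> I k" "n \<ge> 3" for n k i j
  proof -
    have d: "real (Suc i) / 2 ^ k - real i / 2 ^ k = 1 / 2 ^ k" by (simp add: diff_divide_distrib[symmetric])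
    have ij: "real i / 2 ^ k \<in> {0..1}" "real (Suc i) / 2 ^ k \<in> {0..1}" "real j / 2 ^ k \<in> {0..1}"
      using that(1) by (auto simp: I_def intro!: pt[unfolded atLeastAtMost_iff] simp del: of_nat_Suc)
    have lt: "real i / 2 ^ k < real (Suc i) / 2 ^ k" by (simp add: divide_strict_right_mono)
    have "measure M (H n k i j) \<le> 2 * exp (- ((th n k)\<^sup>2 / (C * (1 / 2 ^ k))))"
      unfolding H_def using hor[OF _ lt _ ij(3) thpos[OF that(2), of k], of n] ij unfolding d by auto
    then show "measure M (H n k i j) \<le> 2 * (1 / 16) ^ k * (1 / real n ^ 2)"
      using dyadic_link_tail_bound[OF C that(2) L(2), of k] unfolding th_def by linarith
    have "measure M (V n k i j) \<le> 2 * exp (- ((th n k)\<^sup>2 / (C * (1 / 2 ^ k))))"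
      unfolding V_def using ver[OF _ lt _ ij(3) thpos[OF that(2), of k], of n] ij unfolding d by auto
    then show "measure M (V n k i j) \<le> 2 * (1 / 16) ^ k * (1 / real n ^ 2)"
      using dyadic_link_tail_bound[OF C that(2) L(2), of k] unfolding th_def by linarith
  qed
  have Bm: "measure M (B n k) \<le> 8 * (1 / 4) ^ k * (1 / real n ^ 2)" if n: "n \<ge> 3" for n k
  proof -
    have "measure M (B n k) \<le> (\<Sum>(i, j)\<in>I k. measure M (H n k i j \<union> V n k i j))"
      unfolding B_def case_prod_unfold using Hs Vs fin by (intro measure_UNION_le) auto
    also have "\<dots> \<le> (\<Sum>(i, j)\<in>I k. 4 * (1 / 16) ^ k * (1 / real n ^ 2))"
    proof (intro sum_mono, safe)
      fix i j assume ij: "(i, j) \<in> I k"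
      have "measure M (H n k i j \<union> V n k i j) \<le> measure M (H n k i j) + measure M (V n k i j)"
        using Hs[OF ij] Vs[OF ij] by (intro measure_Un_le)
      also have "\<dots> \<le> 4 * (1 / 16) ^ k * (1 / real n ^ 2)"
        using HV[OF ij n] by simp
      finally show "measure M (H n k i j \<union> V n k i j) \<le> 4 * (1 / 16) ^ k * (1 / real n ^ 2)" .
    qed
    also have "\<dots> = (2 ^ k * (2 ^ k + 1)) * (4 * (1 / 16) ^ k * (1 / real n ^ 2))"
      by (simp add: I_def case_prod_unfold card_cartesian_product algebra_simps)
    also have "\<dots> \<le> (2 ^ k * (2 * 2 ^ k)) * (4 * (1 / 16) ^ k * (1 / real n ^ 2))"
      by (intro mult_right_mono mult_left_mono) auto
    also have "\<dots> = 8 * (2 ^ k * 2 ^ k * (1 / 16) ^ k) * (1 / real n ^ 2)" by simp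
    also have "2 ^ k * 2 ^ k * (1 / 16) ^ k = (1 / 4 :: real) ^ k"
      by (simp add: power_mult_distrib[symmetric])
    finally show ?thesis .
  qed
  define BB where "BB n = (\<Union>k. B n k)" for n
  have BBs: "BB n \<in> sets M" for n unfolding BB_def using Bs by auto
  have geo: "summable (\<lambda>k. 8 * (1 / 4 :: real) ^ k * c)" for c
    by (intro summable_mult2 summable_mult summable_geometric) auto
  have BBm: "measure M (BB n) \<le> (\<Sum>k. 8 * (1 / 4) ^ k) * (1 / real n ^ 2)" if n: "n \<ge> 3" for n
  proof -
    have sB: "summable (\<lambda>k. measure M (B n k))"
      using Bm[OF n] by (intro summable_comparison_test'[OF geo[of "1 / real n ^ 2"], of 0]) auto
    have "measure M (BB n) \<le> (\<Sum>k. measure M (B n k))"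
      unfolding BB_def using Bs by (intro finite_measure_subadditive_countably sB) auto
    also have "\<dots> \<le> (\<Sum>k. 8 * (1 / 4) ^ k * (1 / real n ^ 2))"
      using Bm[OF n] by (intro suminf_le sB geo) auto
    also have "\<dots> = (\<Sum>k. 8 * (1 / 4) ^ k) * (1 / real n ^ 2)"
      using geo[of 1] by (intro suminf_mult2[symmetric]) simp
    finally show ?thesis .
  qed
  have "AE \<omega> in M. \<forall>\<^sub>F n in sequentially. \<omega> \<in> space M - BB n"
  proof (rule borel_cantelli_AE1[OF BBs])
    show "emeasure M (BB n) < \<infinity>" for n by (simp add: less_top[symmetric])
    have "summable (\<lambda>n. (\<Sum>k. 8 * (1 / 4) ^ k) * (1 / real n ^ 2))"
      using inverse_power_summable[of 2, where 'a = real] by (intro summable_mult) (simp add: divide_inverse)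
    then show "summable (\<lambda>n. measure M (BB n))"
      by (rule summable_comparison_test'[of _ 3]) (use BBm in auto)
  qed
  then show ?thesis
    using cont
  proof eventually_elim
    case (elim \<omega>)
    have "\<forall>\<^sub>F n in sequentially. (n::nat) \<ge> 3" by (rule eventually_ge_at_top)
    with elim(1) show ?case
    proof eventually_elim
      case (elim n)
      have nb: "\<omega> \<notin> H n k i j \<union> V n k i j" if "(i, j) \<in> I k" for k i j
        using elim that by (auto simp: BB_def B_def)
      show ?case
      proof (intro ballI)
        fix s r :: real assume sr: "s \<in> {0..1}" "r \<in> {0..1}"
        have "\<bar>Y n s r \<omega>\<bar> \<le> 2 * (L * sqrt (ln (real n))) / (1 - 3 / 4)"
        proof (rule dyadic_chain_bound_continuous[where f = "\<lambda>s r. Y n s r \<omega>"])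
          show "continuous_on ({0..1} \<times> {0..1}) (\<lambda>(x, y). Y n x y \<omega>)"
            using \<open>\<forall>n. continuous_on ({0..1} \<times> {0..1}) (\<lambda>(s, r). Y n s r \<omega>)\<close> by blast
          show "0 \<le> L * sqrt (ln (real n))" using L elim by simp
          fix k i j :: nat assume "i < 2 ^ k" "j \<le> 2 ^ k"
          then have ij: "(i, j) \<in> I k" by (simp add: I_def)
          show "\<bar>Y n (real (Suc i) / 2 ^ k) (real j / 2 ^ k) \<omega> - Y n (real i / 2 ^ k) (real j / 2 ^ k) \<omega>\<bar>
              \<le> L * sqrt (ln (real n)) * (3 / 4) ^ k"
            using nb[OF ij] elim by (auto simp: H_def th_def not_less)
          show "\<bar>Y n (real j / 2 ^ k) (real (Suc i) / 2 ^ k) \<omega> - Y n (real j / 2 ^ k) (real i / 2 ^ k) \<omega>\<bar>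
              \<le> L * sqrt (ln (real n)) * (3 / 4) ^ k"
            using nb[OF ij] elim by (auto simp: V_def th_def not_less)
        qed (use sr Y0 in auto)
        then show "\<bar>Y n s r \<omega>\<bar> \<le> 8 * sqrt (32 * C) * sqrt (ln n)" by (simp add: L_def)
      qed
    qed
  qed
qed

section \<open>From geometric scales to the law of the iterated logarithm\<close>

text \<open>
  Given \<open>h\<close>, take \<open>n\<close> to be the integer part of \<open>- ln (2 * h)\<close>. Then \<open>2 * h \<le> exp (- n) \<le> exp 1 * (2 * h)\<close>
  and \<open>n \<le> ln (1 / h)\<close>, so the bound at scale \<open>n\<close> is the desired one up to the factor \<open>sqrt (2 * exp 1)\<close>.
\<close>

lemma Limsup_loglog_from_geometric_scales:
  fixes f :: "real \<Rightarrow> real"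
  assumes K0: "0 \<le> K0"
    and f: "\<And>n \<rho>. n \<ge> n0 \<Longrightarrow> 0 \<le> \<rho> \<Longrightarrow> \<rho> \<le> exp (- real n) \<Longrightarrow>
       \<bar>f \<rho>\<bar> \<le> K0 * sqrt (ln (real n)) * sqrt (exp (- real n))"
  shows "Limsup (at_right 0) (\<lambda>h. ereal (\<bar>f (2 * h)\<bar> / sqrt (h * ln (ln (1 / h))))) \<le> ereal (K0 * sqrt (2 * exp 1))"
proof (rule Limsup_bounded)
  have bound: "\<bar>f (2 * h)\<bar> / sqrt (h * ln (ln (1 / h))) \<le> K0 * sqrt (2 * exp 1)"
    if h: "0 < h" "h < exp (- real (n0 + 3)) / 2" for h
  proof -
    define x where "x = - ln (2 * h)"
    define n where "n = nat \<lfloor>x\<rfloor>"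
    have "ln (2 * h) < ln (exp (- real (n0 + 3)))"
      using h by (subst ln_less_cancel_iff) auto
    then have x: "x > real (n0 + 3)" unfolding x_def ln_exp by linarith
    have nx: "real n \<le> x" "x < real n + 1" using x unfolding n_def by linarith+
    have n: "n \<ge> n0" "n \<ge> 3" using x nx by linarith+
    have h2: "2 * h = exp (- x)" using h by (simp add: x_def)
    have hd: "2 * h \<le> exp (- real n)" unfolding h2 using nx by simp
    have dh: "exp (- real n) \<le> 2 * exp 1 * h"
    proof -
      have "exp (- real n) \<le> exp (1 + - x)" using nx by simp
      also have "\<dots> = exp 1 * (2 * h)" unfolding h2 by (rule exp_add)
      finally show ?thesis by (simp only: mult.assoc mult.left_commute)
    qed
    have xl: "x \<le> ln (1 / h)"
      using h ln_gt_zero[of 2] by (simp add: x_def ln_mult ln_div)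
    have lx: "ln (real n) \<le> ln (ln (1 / h))"
      using n nx xl by (subst ln_le_cancel_iff) auto
    have lpos: "ln (real n) > 0" using n by simp
    have "\<bar>f (2 * h)\<bar> \<le> K0 * sqrt (ln (real n)) * sqrt (exp (- real n))"
      using f[OF n(1) _ hd] h by simp
    also have "\<dots> \<le> K0 * sqrt (ln (ln (1 / h))) * sqrt (2 * exp 1 * h)"
      using lx lpos dh K0 by (intro mult_mono real_sqrt_le_mono mult_nonneg_nonneg) auto
    also have "\<dots> = (K0 * sqrt (2 * exp 1)) * sqrt (h * ln (ln (1 / h)))"
      by (simp only: real_sqrt_mult ac_simps)
    finally have le: "\<bar>f (2 * h)\<bar> \<le> (K0 * sqrt (2 * exp 1)) * sqrt (h * ln (ln (1 / h)))" .
    have "0 < sqrt (h * ln (ln (1 / h)))"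
      using lx lpos h by (intro real_sqrt_gt_zero mult_pos_pos) auto
    then show ?thesis using le by (simp only: pos_divide_le_eq)
  qed
  have "\<forall>\<^sub>F h in at_right 0. 0 < (h::real) \<and> h < exp (- real (n0 + 3)) / 2"
    unfolding eventually_at_right_field by (intro exI[of _ "exp (- real (n0 + 3)) / 2"]) auto
  then show "\<forall>\<^sub>F h in at_right 0. ereal (\<bar>f (2 * h)\<bar> / sqrt (h * ln (ln (1 / h)))) \<le> ereal (K0 * sqrt (2 * exp 1))"
    by (rule eventually_mono) (use bound in \<open>simp only: ereal_less_eq\<close>)
qed

text \<open>
  The chaining bound applied to the increments over \<open>[p0, p0 + exp (- n)]\<close>, with both coordinates
  rescaled to the unit interval and the values divided by the square root of \<open>exp (- n)\<close>. The rescaling absorbs the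
  length \<open>exp (- n)\<close> from the variances, so that one constant \<open>c * (Q + 1)\<close> serves for all \<open>n\<close> and for both directions.
\<close>

lemma increment_sqrt_ln_bound:
  fixes v :: "real \<Rightarrow> real \<Rightarrow> 'w \<Rightarrow> real"
  assumes M: "prob_space M" and c: "c > 0" and Q: "Q > 0"
    and vm: "\<And>q p. q \<in> {0..Q} \<Longrightarrow> p \<in> {p0..p0 + 1} \<Longrightarrow> v q p \<in> borel_measurable M"
    and cont: "AE \<omega> in M. continuous_on ({0..Q} \<times> {p0..p0 + 1}) (\<lambda>(q, p). v q p \<omega>)"
    and ver: "\<And>q p p' l. q \<in> {0..Q} \<Longrightarrow> p0 \<le> p \<Longrightarrow> p < p' \<Longrightarrow> p' \<le> p0 + 1 \<Longrightarrow> l > 0 \<Longrightarrow>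
       measure M {\<omega>\<in>space M. \<bar>v q p' \<omega> - v q p \<omega>\<bar> > l} \<le> 2 * exp (- (l\<^sup>2 / (c * (p' - p))))"
    and hor: "\<And>q q' p p' l. 0 \<le> q \<Longrightarrow> q < q' \<Longrightarrow> q' \<le> Q \<Longrightarrow> p0 \<le> p \<Longrightarrow> p < p' \<Longrightarrow> p' \<le> p0 + 1 \<Longrightarrow> l > 0 \<Longrightarrow>
        measure M {\<omega>\<in>space M. \<bar>v q' p' \<omega> - v q' p \<omega> - v q p' \<omega> + v q p \<omega>\<bar> > l}
          \<le> 2 * exp (- (l\<^sup>2 / (c * ((q' - q) * (p' - p)))))"
  shows "AE \<omega> in M. \<forall>\<^sub>F n in sequentially. \<forall>q\<in>{0..Q}. \<forall>\<rho>\<in>{0..exp (- real n)}.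
      \<bar>v q (p0 + \<rho>) \<omega> - v q p0 \<omega>\<bar> \<le> 8 * sqrt (32 * (c * (Q + 1))) * sqrt (ln (real n)) * sqrt (exp (- real n))"
proof -
  interpret prob_space M by fact
  define C where "C = c * (Q + 1)"
  have C: "C > 0" using c Q by (simp add: C_def)
  define \<delta> where "\<delta> n = exp (- real n)" for n
  have d: "0 < \<delta> n" "\<delta> n \<le> 1" for n by (auto simp: \<delta>_def)
  define Y where "Y n s r \<omega> = (v (Q * s) (p0 + \<delta> n * r) \<omega> - v (Q * s) p0 \<omega>) / sqrt (\<delta> n)" for n s r \<omega>
  have dr: "0 \<le> \<delta> n * r" "\<delta> n * r \<le> 1" if "r \<in> {0..1}" for n r
    using d[of n] that mult_mono[of "\<delta> n" 1 r 1] by auto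
  have Qs: "Q * s \<in> {0..Q}" if "s \<in> {0..1}" for s
    using Q that by (auto simp: mult_left_le)
  have scale: "\<bar>x / sqrt (\<delta> n)\<bar> > l \<longleftrightarrow> \<bar>x\<bar> > l * sqrt (\<delta> n)" for x l n
    using d[of n] by (simp add: abs_divide pos_less_divide_eq)
  have lpos: "0 < l * sqrt (\<delta> n)" if "0 < l" for l n using that d[of n] by simp
  \<comment> \<open>The factor \<open>\<delta> n\<close> in the variances cancels against the normalisation by \<open>sqrt (\<delta> n)\<close>.\<close>
  have expo: "2 * exp (- ((l * sqrt (\<delta> n))\<^sup>2 / (c * D))) \<le> 2 * exp (- (l\<^sup>2 / (C * e)))"
    if "0 < D" "D \<le> (Q + 1) * (\<delta> n * e)" "0 < e" for l n D e
  proof -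
    have "(l * sqrt (\<delta> n))\<^sup>2 = l\<^sup>2 * \<delta> n" using d[of n] by (simp add: power_mult_distrib)
    moreover have "l\<^sup>2 / (C * e) = l\<^sup>2 * \<delta> n / (C * e * \<delta> n)"
      using d[of n] by simp
    moreover have "C * e * \<delta> n = c * ((Q + 1) * (\<delta> n * e))" by (simp add: C_def)
    moreover have "l\<^sup>2 * \<delta> n / (c * ((Q + 1) * (\<delta> n * e))) \<le> l\<^sup>2 * \<delta> n / (c * D)"
    proof (rule divide_left_mono)
      show "c * D \<le> c * ((Q + 1) * (\<delta> n * e))" using that c by (intro mult_left_mono) auto
      show "0 \<le> l\<^sup>2 * \<delta> n" using d[of n] by simp
      show "0 < c * ((Q + 1) * (\<delta> n * e)) * (c * D)"
        using that c Q d[of n] by (intro mult_pos_pos) auto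
    qed
    ultimately show ?thesis by simp
  qed
  have "AE \<omega> in M. \<forall>\<^sub>F n in sequentially. \<forall>s\<in>{0..1}. \<forall>r\<in>{0..1}.
        \<bar>Y n s r \<omega>\<bar> \<le> 8 * sqrt (32 * C) * sqrt (ln n)"
  proof (rule chaining_sqrt_ln_bound[OF M C])
    fix n and s r :: real assume s: "s \<in> {0..1}" and r: "r \<in> {0..1}"
    have "v (Q * s) (p0 + \<delta> n * r) \<in> borel_measurable M" "v (Q * s) p0 \<in> borel_measurable M"
      using dr[OF r, of n] by (intro vm Qs[OF s]; simp)+
    then show "Y n s r \<in> borel_measurable M"
      unfolding Y_def[abs_def] by (intro borel_measurable_divide borel_measurable_diff borel_measurable_const)
  next
    show "Y n 0 0 \<omega> = 0" for n \<omega> by (simp add: Y_def)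
  next
    show "AE \<omega> in M. \<forall>n. continuous_on ({0..1} \<times> {0..1}) (\<lambda>(s, r). Y n s r \<omega>)"
      using cont
    proof eventually_elim
      case (elim \<omega>)
      show ?case
      proof
        fix n
        have pre: "continuous_on ({0..1} \<times> {0..1}) (\<lambda>z. (\<lambda>(q, p). v q p \<omega>) (Q * fst z, g (snd z)))"
          if "continuous_on UNIV g" "\<And>r. r \<in> {0..1} \<Longrightarrow> g r \<in> {p0..p0 + 1}" for g :: "real \<Rightarrow> real"
        proof (rule continuous_on_compose2[OF elim])
          show "continuous_on ({0..1} \<times> {0..1}) (\<lambda>z. (Q * fst z, g (snd z)))"
            by (intro continuous_intros continuous_on_compose2[OF that(1)]) auto
          show "(\<lambda>z. (Q * fst z, g (snd z))) ` ({0..1} \<times> {0..1}) \<subseteq> {0..Q} \<times> {p0..p0 + 1}"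
            using Qs that(2) by fastforce
        qed
        have "continuous_on ({0..1} \<times> {0..1}) (\<lambda>z. (\<lambda>(q, p). v q p \<omega>) (Q * fst z, p0 + \<delta> n * snd z))"
          by (rule pre[of "\<lambda>r. p0 + \<delta> n * r"]) (use dr[of _ n] in \<open>auto intro!: continuous_intros\<close>)
        moreover have "continuous_on ({0..1} \<times> {0..1::real}) (\<lambda>z. (\<lambda>(q, p). v q p \<omega>) (Q * fst z, p0))"
          by (rule pre[of "\<lambda>_. p0"]) auto
        ultimately have "continuous_on ({0..1} \<times> {0..1}) (\<lambda>z. (v (Q * fst z) (p0 + \<delta> n * snd z) \<omega> - v (Q * fst z) p0 \<omega>) / sqrt (\<delta> n))"
          using d[of n] by (intro continuous_on_divide continuous_on_diff continuous_on_const) auto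
        then show "continuous_on ({0..1} \<times> {0..1}) (\<lambda>(s, r). Y n s r \<omega>)"
          unfolding Y_def case_prod_unfold .
      qed
    qed
  next
    fix n :: nat and s s' r l :: real
    assume s: "0 \<le> s" "s < s'" "s' \<le> 1" and r: "r \<in> {0..1}" and l: "l > 0"
    show "measure M {\<omega> \<in> space M. \<bar>Y n s' r \<omega> - Y n s r \<omega>\<bar> > l} \<le> 2 * exp (- (l\<^sup>2 / (C * (s' - s))))"
    proof (cases "r = 0")
      case True
      then show ?thesis using l by (simp add: Y_def)
    next
      case False
      with r have r0: "0 < r" "r \<le> 1" by auto
      have dr0: "0 < \<delta> n * r" using d[of n] r0 by simp
      have Yd: "Y n s' r \<omega> - Y n s r \<omega> = (v (Q * s') (p0 + \<delta> n * r) \<omega> - v (Q * s') p0 \<omega>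
            - v (Q * s) (p0 + \<delta> n * r) \<omega> + v (Q * s) p0 \<omega>) / sqrt (\<delta> n)" for \<omega>
        by (simp add: Y_def diff_divide_distrib add_divide_distrib)
      have ss: "Q * s < Q * s'" using Q s by simp
      have "measure M {\<omega> \<in> space M. \<bar>Y n s' r \<omega> - Y n s r \<omega>\<bar> > l}
            \<le> 2 * exp (- ((l * sqrt (\<delta> n))\<^sup>2 / (c * ((Q * s' - Q * s) * ((p0 + \<delta> n * r) - p0)))))"
        unfolding Yd scale
        by (rule hor[OF _ ss _ order_refl _ _ lpos[OF l]]) (use Qs[of s] Qs[of s'] s dr[OF r, of n] dr0 in auto)
      also have "\<dots> \<le> 2 * exp (- (l\<^sup>2 / (C * (s' - s))))"
      proof (rule expo)
        have "Q * r \<le> (Q + 1) * 1" using r0 Q by (intro mult_mono) auto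
        then have "(Q * r) * (\<delta> n * (s' - s)) \<le> (Q + 1) * 1 * (\<delta> n * (s' - s))"
          using d[of n] s by (intro mult_right_mono) auto
        then show "(Q * s' - Q * s) * ((p0 + \<delta> n * r) - p0) \<le> (Q + 1) * (\<delta> n * (s' - s))"
          by (simp add: algebra_simps)
        show "0 < (Q * s' - Q * s) * ((p0 + \<delta> n * r) - p0)" using ss dr0 by (intro mult_pos_pos) auto
      qed (use s in simp)
      finally show ?thesis .
    qed
  next
    fix n :: nat and s r r' l :: real
    assume r: "0 \<le> r" "r < r'" "r' \<le> 1" and s: "s \<in> {0..1}" and l: "l > 0"
    have Yd: "Y n s r' \<omega> - Y n s r \<omega> = (v (Q * s) (p0 + \<delta> n * r') \<omega> - v (Q * s) (p0 + \<delta> n * r) \<omega>) / sqrt (\<delta> n)" for \<omega>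
      by (simp add: Y_def diff_divide_distrib)
    have rr: "\<delta> n * r < \<delta> n * r'" using d[of n] r by simp
    have "measure M {\<omega> \<in> space M. \<bar>Y n s r' \<omega> - Y n s r \<omega>\<bar> > l}
            \<le> 2 * exp (- ((l * sqrt (\<delta> n))\<^sup>2 / (c * ((p0 + \<delta> n * r') - (p0 + \<delta> n * r)))))"
      unfolding Yd scale
      by (rule ver[OF Qs[OF s] _ _ _ lpos[OF l]]) (use r rr dr[of r n] dr[of r' n] in auto)
    also have "\<dots> \<le> 2 * exp (- (l\<^sup>2 / (C * (r' - r))))"
    proof (rule expo)
      have "1 * (\<delta> n * (r' - r)) \<le> (Q + 1) * (\<delta> n * (r' - r))"
        using d[of n] r Q by (intro mult_right_mono) auto
      then show "(p0 + \<delta> n * r') - (p0 + \<delta> n * r) \<le> (Q + 1) * (\<delta> n * (r' - r))"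
        by (simp add: algebra_simps)
    qed (use r rr in auto)
    finally show "measure M {\<omega> \<in> space M. \<bar>Y n s r' \<omega> - Y n s r \<omega>\<bar> > l} \<le> 2 * exp (- (l\<^sup>2 / (C * (r' - r))))" .
  qed
  then show ?thesis
  proof eventually_elim
    case (elim \<omega>)
    then show ?case
    proof eventually_elim
      case (elim n)
      show ?case
      proof (intro ballI)
        fix q \<rho> assume q: "q \<in> {0..Q}" and \<rho>: "\<rho> \<in> {0..exp (- real n)}"
        have s: "q / Q \<in> {0..1}" "Q * (q / Q) = q" using q Q by auto
        have r: "\<rho> / \<delta> n \<in> {0..1}" "\<delta> n * (\<rho> / \<delta> n) = \<rho>" using \<rho> d[of n] by (auto simp: \<delta>_def)
        have "\<bar>v q (p0 + \<rho>) \<omega> - v q p0 \<omega>\<bar> = \<bar>Y n (q / Q) (\<rho> / \<delta> n) \<omega>\<bar> * sqrt (\<delta> n)"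
          unfolding Y_def s(2) r(2) using d[of n] by (simp add: abs_divide)
        also have "\<dots> \<le> (8 * sqrt (32 * C) * sqrt (ln (real n))) * sqrt (\<delta> n)"
          using elim s(1) r(1) d[of n] by (intro mult_right_mono) auto
        finally show "\<bar>v q (p0 + \<rho>) \<omega> - v q p0 \<omega>\<bar>
            \<le> 8 * sqrt (32 * (c * (Q + 1))) * sqrt (ln (real n)) * sqrt (exp (- real n))"
          by (simp only: C_def \<delta>_def)
      qed
    qed
  qed
qed

theorem theorem1p3:
  fixes M :: "'w measure"
    and W :: "(real \<times> real) set \<Rightarrow> 'w \<Rightarrow> real"
    and G :: "real \<Rightarrow> real \<Rightarrow> real"
    and u :: "real \<Rightarrow> real \<Rightarrow> 'w \<Rightarrow> real"
    and a m N a1 a2 :: real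
  assumes "prob_space M" and "complete_measure M"
    and "white_noise M W"
    and "fundamental_solution a m G"
    and "mild_solution M W G u"
    and "continuous_paths M u"
    and "N > 0" and "0 < a1" and "a1 < a2"
  shows "\<exists>K2::real. 0 < K2 \<and>
    (\<forall>z0\<in>{a1..a2}.
      measure M {\<omega> \<in> space M. \<forall>w\<in>{0..N}.
        Limsup (at_right 0)
          (\<lambda>h. ereal (\<bar>u ((w + z0) / sqrt 2 + h) ((- w + z0) / sqrt 2 + h) \<omega>
                        - u ((w + z0) / sqrt 2) ((- w + z0) / sqrt 2) \<omega>\<bar>
                      / sqrt (h * ln (ln (1 / h)))))
        \<le> ereal K2} = 1)"
proof -
  interpret prob_space M by fact
  interpret complete_measure M by fact
  define v where "v q p = u ((q + p) / 2) ((p - q) / 2)" for q p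
  define Q where "Q = sqrt 2 * N"
  define R where "R = Q + sqrt 2 * a2 + 1"
  have Q: "Q > 0" using \<open>N > 0\<close> by (simp add: Q_def)
  have "0 < sqrt 2 * a2" using assms(8,9) by (intro mult_pos_pos) auto
  then have R: "R > 0" using Q by (simp add: R_def)
  obtain c where c: "c > 0"
    and tails: "\<forall>q p p'. 0 \<le> q \<longrightarrow> 0 \<le> p \<longrightarrow> p < p' \<longrightarrow> q + p' \<le> R \<longrightarrow>
     (\<forall>l>0. measure M {\<omega>\<in>space M. \<bar>v q p' \<omega> - v q p \<omega>\<bar> > l} \<le> 2 * exp (- (l\<^sup>2 / (c * (p' - p))))) \<and>
     (\<forall>q' l. q < q' \<longrightarrow> q' + p' \<le> R \<longrightarrow> l > 0 \<longrightarrow>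
        measure M {\<omega>\<in>space M. \<bar>v q' p' \<omega> - v q' p \<omega> - v q p' \<omega> + v q p \<omega>\<bar> > l}
          \<le> 2 * exp (- (l\<^sup>2 / (c * ((q' - q) * (p' - p))))))"
    using mild_solution_increment_tails[OF assms(1,3,4,5) R, folded v_def] by (elim exE conjE)
  define K0 where "K0 = 8 * sqrt (32 * (c * (Q + 1)))"
  define K where "K = K0 * sqrt (2 * exp 1)"
  have K0: "K0 > 0" using c Q by (simp add: K0_def)
  then have K: "K > 0" by (simp add: K_def)
  have vm: "v q p \<in> borel_measurable M" if "0 \<le> q" "0 \<le> p" for q p
  proof -
    have "0 \<le> (q + p) / 2" using that by simp
    then show ?thesis using assms(5) unfolding mild_solution_def v_def has_wiener_integral_def by blast
  qed
  let ?L = "\<lambda>z0 w \<omega>. Limsup (at_right 0)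
          (\<lambda>h. ereal (\<bar>u ((w + z0) / sqrt 2 + h) ((- w + z0) / sqrt 2 + h) \<omega>
                        - u ((w + z0) / sqrt 2) ((- w + z0) / sqrt 2) \<omega>\<bar>
                      / sqrt (h * ln (ln (1 / h)))))"
  have main: "AE \<omega> in M. \<forall>w\<in>{0..N}. ?L z0 w \<omega> \<le> ereal K" if z0: "z0 \<in> {a1..a2}" for z0
  proof -
    define p0 where "p0 = sqrt 2 * z0"
    have "sqrt 2 * z0 \<le> sqrt 2 * a2" using z0 by simp
    then have p0: "0 \<le> p0" "Q + (p0 + 1) \<le> R"
      using z0 assms(8) by (auto simp: p0_def R_def)
    have "AE \<omega> in M. \<forall>\<^sub>F n in sequentially. \<forall>q\<in>{0..Q}. \<forall>\<rho>\<in>{0..exp (- real n)}.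
      \<bar>v q (p0 + \<rho>) \<omega> - v q p0 \<omega>\<bar> \<le> 8 * sqrt (32 * (c * (Q + 1))) * sqrt (ln (real n)) * sqrt (exp (- real n))"
    proof (rule increment_sqrt_ln_bound[OF assms(1) c Q])
      show "v q p \<in> borel_measurable M" if "q \<in> {0..Q}" "p \<in> {p0..p0 + 1}" for q p
        using vm that p0 by simp
      have "AE \<omega> in M. continuous_on spacetime (\<lambda>(t, x). u t x \<omega>)"
        using assms(6) by (simp add: continuous_paths_def)
      then show "AE \<omega> in M. continuous_on ({0..Q} \<times> {p0..p0 + 1}) (\<lambda>(q, p). v q p \<omega>)"
      proof eventually_elim
        case (elim \<omega>)
        have "continuous_on ({0..Q} \<times> {p0..p0 + 1})
          (\<lambda>z. (\<lambda>(t, x). u t x \<omega>) ((fst z + snd z) / 2, (snd z - fst z) / 2))"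
        proof (rule continuous_on_compose2[OF elim])
          show "continuous_on ({0..Q} \<times> {p0..p0 + 1}) (\<lambda>z. ((fst z + snd z) / 2, (snd z - fst z) / 2))"
            by (intro continuous_intros) auto
          show "(\<lambda>z. ((fst z + snd z) / 2, (snd z - fst z) / 2)) ` ({0..Q} \<times> {p0..p0 + 1}) \<subseteq> spacetime"
            using p0 by (auto simp: spacetime_def)
        qed
        then show ?case unfolding v_def by (simp only: case_prod_unfold fst_conv snd_conv)
      qed
    next
      fix q p p' l :: real
      assume *: "q \<in> {0..Q}" "p0 \<le> p" "p < p'" "p' \<le> p0 + 1" "l > 0"
      have "0 \<le> q" "0 \<le> p" "q + p' \<le> R" using * p0 by auto
      from tails[rule_format, OF this(1,2) *(3) this(3), THEN conjunct1, rule_format, OF *(5)]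
      show "measure M {\<omega>\<in>space M. \<bar>v q p' \<omega> - v q p \<omega>\<bar> > l} \<le> 2 * exp (- (l\<^sup>2 / (c * (p' - p))))" .
    next
      fix q q' p p' l :: real
      assume *: "0 \<le> q" "q < q'" "q' \<le> Q" "p0 \<le> p" "p < p'" "p' \<le> p0 + 1" "l > 0"
      have "0 \<le> p" "q + p' \<le> R" "q' + p' \<le> R" using * p0 by auto
      from tails[rule_format, OF *(1) this(1) *(5) this(2), THEN conjunct2, rule_format, OF *(2) this(3) *(7)]
      show "measure M {\<omega>\<in>space M. \<bar>v q' p' \<omega> - v q' p \<omega> - v q p' \<omega> + v q p \<omega>\<bar> > l}
          \<le> 2 * exp (- (l\<^sup>2 / (c * ((q' - q) * (p' - p)))))" .
    qed
    then show ?thesis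
    proof eventually_elim
      case (elim \<omega>)
      then obtain n0 where n0: "\<And>n q \<rho>. n \<ge> n0 \<Longrightarrow> q \<in> {0..Q} \<Longrightarrow> \<rho> \<in> {0..exp (- real n)} \<Longrightarrow>
          \<bar>v q (p0 + \<rho>) \<omega> - v q p0 \<omega>\<bar> \<le> K0 * sqrt (ln (real n)) * sqrt (exp (- real n))"
        unfolding eventually_sequentially K0_def by blast
      show ?case
      proof
        fix w assume w: "w \<in> {0..N}"
        define q where "q = sqrt 2 * w"
        have q: "q \<in> {0..Q}" using w by (auto simp: q_def Q_def)
        have half: "x / sqrt 2 = sqrt 2 * x / 2" for x :: real
        proof -
          have "sqrt 2 * x / 2 = sqrt 2 * x / (sqrt 2 * sqrt 2)" by simp
          also have "\<dots> = x / sqrt 2" by (rule mult_divide_mult_cancel_left) simp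
          finally show ?thesis ..
        qed
        have t: "(w + z0) / sqrt 2 = (q + p0) / 2" "(- w + z0) / sqrt 2 = (p0 - q) / 2"
          unfolding half q_def p0_def by (simp_all add: algebra_simps)
        have th: "(q + p0) / 2 + h = (q + (p0 + 2 * h)) / 2" "(p0 - q) / 2 + h = ((p0 + 2 * h) - q) / 2" for h
          by (simp_all add: field_simps)
        have "Limsup (at_right 0) (\<lambda>h. ereal (\<bar>v q (p0 + 2 * h) \<omega> - v q p0 \<omega>\<bar> / sqrt (h * ln (ln (1 / h))))) \<le> ereal K"
          unfolding K_def
          by (rule Limsup_loglog_from_geometric_scales[of K0 n0 "\<lambda>\<rho>. v q (p0 + \<rho>) \<omega> - v q p0 \<omega>"])
             (use K0 n0 q in auto)
        then show "?L z0 w \<omega> \<le> ereal K" unfolding t th v_def .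
      qed
    qed
  qed
  show ?thesis
  proof (intro exI[of _ K] conjI ballI K)
    fix z0 assume z0: "z0 \<in> {a1..a2}"
    let ?P = "\<lambda>\<omega>. \<forall>w\<in>{0..N}. ?L z0 w \<omega> \<le> ereal K"
    obtain Z where Z: "{\<omega> \<in> space M. \<not> ?P \<omega>} \<subseteq> Z" "emeasure M Z = 0" "Z \<in> sets M"
      using main[OF z0] by (rule AE_E)
    \<comment> \<open>Measurability of the event, an uncountable intersection, comes from completeness.\<close>
    have "{\<omega> \<in> space M. \<not> ?P \<omega>} \<in> sets M"
      by (rule complete[OF Z(1)]) (use Z in \<open>simp add: null_sets_def\<close>)
    then have "space M - {\<omega> \<in> space M. \<not> ?P \<omega>} \<in> sets M" by (rule sets.compl_sets)
    moreover have "space M - {\<omega> \<in> space M. \<not> ?P \<omega>} = {\<omega> \<in> space M. ?P \<omega>}" by blast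
    ultimately have m: "{\<omega> \<in> space M. ?P \<omega>} \<in> sets M" by (simp only:)
    show "measure M {\<omega> \<in> space M. ?P \<omega>} = 1"
      by (rule prob_Collect_eq_1[OF m, THEN iffD2, OF main[OF z0]])
  qed
qed

end
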